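(* Let $d\ge 1$ be an integer. For every $s\in(0,d)$ and every $c\in(0,1)$, there exists a self-similar set $K\subset\mathbb{R}^d$, generated by an iterated function system of similitudes on $\mathbb{R}^d$ satisfying the strong separation condition, such that $\dim_{\rm H}K=s$ and $\mathcal{H}^s(K)=c\,|K|^s$.
   Context: $\mathbb{R}^d$ carries the Euclidean norm, and $|A|$ denotes the diameter of $A\subset\mathbb{R}^d$. An iterated function system (IFS) of similitudes on $\mathbb{R}^d$ is a finite family $\Phi=\{\phi_i\}_{i=1}^{\ell}$ of contracting similitudes $\phi_i:\mathbb{R}^d\to\mathbb{R}^d$, i.e. $\|\phi_i(x)-\phi_i(y)\|=r_i\|x-y\|$ for all $x,y\in\mathbb{R}^d$, with $r_i\in(0,1)$. The self-similar set (attractor) generated by $\Phi$ is the unique non-empty compact set $K\subset\mathbb{R}^d$ with $K=\bigcup_{i=1}^{\ell}\phi_i(K)$. The IFS $\Phi$ satisfies the strong separation condition (SSC) if $\phi_i(K)\cap\phi_j(K)=\emptyset$ for all distinct $i,j\in\{1,\ldots,\ell\}$. $\dim_{\rm H}$ is Hausdorff dimension and $\mathcal{H}^s$ is the $s$-dimensional Hausdorff measure, normalized without any multiplicative constant: $\mathcal{H}^s(A)=\lim_{\delta\to0}\inf\{\sum_{i}|U_i|^s: A\subset\bigcup_{i}U_i,\ |U_i|\le\delta\}$, the infimum being over countable covers. *)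

theory Defs
  imports "HOL-Analysis.Analysis"
begin

text \<open>
  The summand \<open>|U|\<^sup>s\<close> for \<open>s \<ge> 0\<close>. The case distinction is there because \<open>0 powr 0 = 0\<close> in HOL,
  whereas \<open>\<H>\<^sup>0\<close> is to be the counting measure.
\<close>
definition diam_pow :: "real \<Rightarrow> 'a::metric_space set \<Rightarrow> ennreal" where
  "diam_pow s U =
    (if U = {} then 0 else if s = 0 then 1 else ennreal (diameter U powr s))"

text \<open>
  Finite covers are included by padding with empty sets. Boundedness is required explicitly, since
  \<^const>\<open>diameter\<close> is a meaningless real number on unbounded sets.
\<close>
definition delta_covers :: "real \<Rightarrow> 'a::metric_space set \<Rightarrow> (nat \<Rightarrow> 'a set) set" where
  "delta_covers \<delta> A =
    {U. A \<subseteq> (\<Union>i. U i) \<and> (\<forall>i. bounded (U i) \<and> diameter (U i) \<le> \<delta>)}"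

definition hausdorff_premeasure :: "real \<Rightarrow> real \<Rightarrow> 'a::metric_space set \<Rightarrow> ennreal" where
  "hausdorff_premeasure s \<delta> A = (INF U\<in>delta_covers \<delta> A. \<Sum>i. diam_pow s (U i))"

definition hausdorff_measure :: "real \<Rightarrow> 'a::metric_space set \<Rightarrow> ennreal" where
  "hausdorff_measure s A = Lim (at_right 0) (\<lambda>\<delta>. hausdorff_premeasure s \<delta> A)"

definition hausdorff_dim :: "'a::metric_space set \<Rightarrow> ereal" where
  "hausdorff_dim A = Inf {ereal s |s. 0 \<le> s \<and> hausdorff_measure s A = 0}"

lemma hausdorff_premeasure_antimono:
  assumes "\<delta> \<le> \<epsilon>"
  shows "hausdorff_premeasure s \<epsilon> A \<le> hausdorff_premeasure s \<delta> A"
  unfolding hausdorff_premeasure_def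
proof (rule INF_superset_mono)
  show "delta_covers \<delta> A \<subseteq> delta_covers \<epsilon> A"
    using assms by (auto simp: delta_covers_def intro: order_trans)
qed simp

lemma tendsto_hausdorff_premeasure_SUP:
  "((\<lambda>\<delta>. hausdorff_premeasure s \<delta> A) \<longlongrightarrow> (SUP \<delta>\<in>{0<..}. hausdorff_premeasure s \<delta> A)) (at_right 0)"
proof (rule increasing_tendsto)
  show "\<forall>\<^sub>F \<delta> in at_right 0. hausdorff_premeasure s \<delta> A \<le> (SUP \<delta>\<in>{0<..}. hausdorff_premeasure s \<delta> A)"
    by (auto simp: eventually_at_right_field intro!: exI[of _ 1] SUP_upper)
next
  fix x assume "x < (SUP \<delta>\<in>{0<..}. hausdorff_premeasure s \<delta> A)"
  then obtain \<epsilon> where "\<epsilon> > 0" "x < hausdorff_premeasure s \<epsilon> A"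
    by (auto simp: less_SUP_iff)
  then show "\<forall>\<^sub>F \<delta> in at_right 0. x < hausdorff_premeasure s \<delta> A"
    by (auto simp: eventually_at_right_field intro!: exI[of _ \<epsilon>]
        intro: less_le_trans[OF _ hausdorff_premeasure_antimono])
qed

lemma hausdorff_measure_eq_SUP:
  "hausdorff_measure s A = (SUP \<delta>\<in>{0<..}. hausdorff_premeasure s \<delta> A)"
  unfolding hausdorff_measure_def
  by (rule tendsto_Lim[OF _ tendsto_hausdorff_premeasure_SUP]) simp

definition contracting_similitude :: "('a::metric_space \<Rightarrow> 'a) \<Rightarrow> bool" where
  "contracting_similitude f \<longleftrightarrow> (\<exists>r. 0 < r \<and> r < 1 \<and> (\<forall>x y. dist (f x) (f y) = r * dist x y))"

definition similitude_ifs :: "nat \<Rightarrow> (nat \<Rightarrow> 'a::metric_space \<Rightarrow> 'a) \<Rightarrow> bool" where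
  "similitude_ifs l \<phi> \<longleftrightarrow> l \<ge> 1 \<and> (\<forall>i\<in>{1..l}. contracting_similitude (\<phi> i))"

text \<open>
  Stated as a relation: by Hutchinson's theorem, an IFS on a Euclidean space has exactly one
  attractor.
\<close>
definition is_attractor :: "nat \<Rightarrow> (nat \<Rightarrow> 'a::metric_space \<Rightarrow> 'a) \<Rightarrow> 'a set \<Rightarrow> bool" where
  "is_attractor l \<phi> K \<longleftrightarrow> compact K \<and> K \<noteq> {} \<and> K = (\<Union>i\<in>{1..l}. \<phi> i ` K)"

text \<open>To be used with the attractor \<open>K\<close> of \<open>\<phi>\<close>.\<close>
definition strong_separation :: "nat \<Rightarrow> (nat \<Rightarrow> 'a \<Rightarrow> 'a) \<Rightarrow> 'a set \<Rightarrow> bool" where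
  "strong_separation l \<phi> K \<longleftrightarrow>
    (\<forall>i\<in>{1..l}. \<forall>j\<in>{1..l}. i \<noteq> j \<longrightarrow> \<phi> i ` K \<inter> \<phi> j ` K = {})"

end

theory Submission
  imports Defs
begin

text \<open>
  Let \<open>Z\<close> be the set of lattice points in the ball of radius \<open>\<rho>\<close>, \<open>N = |Z|\<close> and \<open>r = N powr (-1/s)\<close>, and let
  \<open>K\<close> be the attractor of the maps \<open>x \<mapsto> z + r x\<close>, \<open>z \<in> Z\<close>. As \<open>s < d\<close>, the pieces of \<open>K\<close> are tiny compared
  with their mutual distances once \<open>\<rho>\<close> is large. A set meeting only one piece can be rescaled; a set meeting
  several has, by the isodiametric inequality for unions of lattice cubes, mass at most about
  \<open>(|U| / |K|)\<^sup>d \<le> (|U| / |K|)\<^sup>s\<close>. Hence \<open>\<H>\<^sup>s(K) / |K|\<^sup>s\<close> is close to \<open>1\<close>.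

  Now move one extreme point \<open>z\<^sub>0\<close> of \<open>Z\<close> away to \<open>t z\<^sub>0\<close>. Up to \<open>t\<close> of order \<open>1 / (\<rho> r)\<close> strong separation
  persists, and at the end \<open>K\<close> consists of one small piece and a cluster whose diameter is tiny
  compared with \<open>|K|\<close>, so the ratio is close to \<open>0\<close>. All other parameters being fixed, the attractors for
  nearby \<open>t\<close> are bi-Lipschitz equivalent with constants close to \<open>1\<close>; so the ratio is continuous in
  \<open>t\<close> and the intermediate value theorem applies.
\<close>

subsection \<open>Hausdorff measures\<close>

text \<open>What must be sharp is the isodiametric inequality: a constant lost there would keep the
  ratio away from 1 for good. Hence the digits fill a Euclidean ball, the extremal shape, and
  Brunn-Minkowski is proved in a discrete form with errors of lower order: lattice points are
  counted against balls enlarged or shrunk by \<open>d\<close>, and the volume of the unit ball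
  cancels. For a set of digits of small diameter these errors are not small; there the power
  \<open>\<rho> powr (s - d)\<close> wins instead, a second use of \<open>s < d\<close>. The slack
  \<open>c < 1\<close> absorbs what remains.

  All maps share one ratio and only translations are moved. So \<open>N * r powr s = 1\<close>, and
  with it the exponent, is untouched by the deformation, and equal addresses match the points of two
  attractors. Moving a digit of maximal norm outwards never brings it closer to the others, which is
  why one uniform gap serves the whole path.

  The lower bound for the measure counts cylinders inside the members of a cover; no measure on
  \<open>K\<close> is constructed. The upper bounds come from explicit covers by one or two
  sets.\<close>

lemma diameter_le_dist:
  fixes S :: "'a::metric_space set"
  assumes "S \<noteq> {} \<or> 0 \<le> d" and "\<And>x y. x \<in> S \<Longrightarrow> y \<in> S \<Longrightarrow> dist x y \<le> d"
  shows "diameter S \<le> d"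
proof (cases "S = {}")
  case False
  then show ?thesis
    unfolding diameter_def using assms(2) by (auto intro!: cSUP_least)
qed (use assms(1) in auto)

text \<open>Multiplication by a finite \<open>c > 0\<close> is inverted by \<open>1 / c\<close> in
  \<open>ennreal\<close>, so it commutes with infima. This is how an estimate for every single cover
  becomes one for the premeasure.\<close>

lemma le_ennreal_cmult_INF:
  fixes f :: "'a \<Rightarrow> ennreal"
  assumes "0 < c" and "\<And>x. x \<in> A \<Longrightarrow> y \<le> ennreal c * f x"
  shows "y \<le> ennreal c * (INF x\<in>A. f x)"
proof -
  have inv: "ennreal (1 / c) * (ennreal c * z) = z" "ennreal c * (ennreal (1 / c) * z) = z" for z
    using assms(1) by (simp_all add: mult.assoc[symmetric] ennreal_mult[symmetric])
  have "ennreal (1 / c) * y \<le> (INF x\<in>A. f x)"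
  proof (rule INF_greatest)
    fix x assume "x \<in> A"
    from mult_left_mono[OF assms(2)[OF this], of "ennreal (1 / c)"]
    show "ennreal (1 / c) * y \<le> f x" by (simp add: inv)
  qed
  from mult_left_mono[OF this, of "ennreal c"] show ?thesis by (simp add: inv)
qed

lemma diam_pow_empty [simp]: "diam_pow s {} = 0"
  by (simp add: diam_pow_def)

lemma diam_pow_pos: "0 < s \<Longrightarrow> diam_pow s U = ennreal (diameter U powr s)"
  by (auto simp: diam_pow_def)

lemma hausdorff_premeasure_le_cover:
  assumes "U \<in> delta_covers \<delta> A"
  shows "hausdorff_premeasure s \<delta> A \<le> (\<Sum>i. diam_pow s (U i))"
  unfolding hausdorff_premeasure_def by (intro INF_lower assms)

lemma hausdorff_premeasure_le_diam_pow:
  assumes "bounded A" "diameter A \<le> \<delta>"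
  shows "hausdorff_premeasure s \<delta> A \<le> diam_pow s A"
proof -
  have "0 \<le> \<delta>"
    using assms diameter_ge_0 order_trans by blast
  define U where "U = (\<lambda>i::nat. if i = 0 then A else {})"
  have "U \<in> delta_covers \<delta> A"
    using assms \<open>0 \<le> \<delta>\<close> by (auto simp: delta_covers_def U_def)
  then have "hausdorff_premeasure s \<delta> A \<le> (\<Sum>i. diam_pow s (U i))"
    by (rule hausdorff_premeasure_le_cover)
  also have "\<dots> = (\<Sum>i\<in>{0}. diam_pow s (U i))"
    by (rule suminf_finite) (auto simp: U_def)
  finally show ?thesis by (simp add: U_def)
qed

lemma hausdorff_premeasure_Un:
  "hausdorff_premeasure s \<delta> (A \<union> B) \<le> hausdorff_premeasure s \<delta> A + hausdorff_premeasure s \<delta> B"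
proof (cases "hausdorff_premeasure s \<delta> A = \<infinity> \<or> hausdorff_premeasure s \<delta> B = \<infinity>")
  case False
  show ?thesis
  proof (rule ennreal_le_epsilon)
    fix e :: real assume "0 < e"
    obtain U where U: "U \<in> delta_covers \<delta> A"
      "(\<Sum>i. diam_pow s (U i)) < hausdorff_premeasure s \<delta> A + ennreal (e / 2)"
      using INF_approx_ennreal[of "e / 2" "hausdorff_premeasure s \<delta> A"] False \<open>0 < e\<close>
      unfolding hausdorff_premeasure_def by auto
    obtain V where V: "V \<in> delta_covers \<delta> B"
      "(\<Sum>i. diam_pow s (V i)) < hausdorff_premeasure s \<delta> B + ennreal (e / 2)"
      using INF_approx_ennreal[of "e / 2" "hausdorff_premeasure s \<delta> B"] False \<open>0 < e\<close>
      unfolding hausdorff_premeasure_def by auto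
    have "bounded (U 0)" "diameter (U 0) \<le> \<delta>"
      using U(1) by (auto simp: delta_covers_def)
    \<comment> \<open>The empty sets that pad the merged cover have diameter 0, which the mesh bound
      must allow.\<close>
    then have "0 \<le> \<delta>"
      using diameter_ge_0 order_trans by blast
    \<comment> \<open>Rows 0 and 1 of a doubly indexed family hold the two covers, all other rows
      are empty; \<open>prod_decode\<close> lists it as one sequence.\<close>
    define W where "W = (\<lambda>(m::nat, n). if m = 0 then U n else if m = 1 then V n else {})"
    have Wc: "W (prod_decode i) \<in> range U \<union> range V \<union> {{}}" for i
      by (auto simp: W_def split: prod.splits)
    have "x \<in> (\<Union>i. W (prod_decode i))" if "x \<in> A \<union> B" for x
    proof -
      obtain m n where "x \<in> W (m, n)"
      proof (cases "x \<in> A")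
        case True
        then obtain n where "x \<in> U n" using U(1) by (auto simp: delta_covers_def)
        then show ?thesis by (intro that[of 0 n]) (simp add: W_def)
      next
        case False
        then obtain n where "x \<in> V n" using V(1) \<open>x \<in> A \<union> B\<close> by (auto simp: delta_covers_def)
        then show ?thesis by (intro that[of 1 n]) (simp add: W_def)
      qed
      then show ?thesis by (auto intro!: exI[of _ "prod_encode (m, n)"])
    qed
    moreover have "bounded (W (prod_decode i)) \<and> diameter (W (prod_decode i)) \<le> \<delta>" for i
      using Wc[of i] U(1) V(1) \<open>0 \<le> \<delta>\<close> by (auto simp: delta_covers_def)
    ultimately have "(\<lambda>i. W (prod_decode i)) \<in> delta_covers \<delta> (A \<union> B)"
      unfolding delta_covers_def by blast
    then have "hausdorff_premeasure s \<delta> (A \<union> B) \<le> (\<Sum>i. diam_pow s (W (prod_decode i)))"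
      by (rule hausdorff_premeasure_le_cover)
    also have "\<dots> = (\<Sum>m. \<Sum>n. diam_pow s (W (m, n)))"
      by (rule suminf_ennreal_2dimen) simp
    also have "\<dots> = (\<Sum>m\<in>{0, 1}. \<Sum>n. diam_pow s (W (m, n)))"
      by (rule suminf_finite) (auto simp: W_def)
    also have "\<dots> = (\<Sum>n. diam_pow s (U n)) + (\<Sum>n. diam_pow s (V n))"
      by (simp add: W_def)
    also have "\<dots> \<le> (hausdorff_premeasure s \<delta> A + ennreal (e / 2)) + (hausdorff_premeasure s \<delta> B + ennreal (e / 2))"
      using U(2) V(2) by (intro add_mono) auto
    also have "\<dots> = hausdorff_premeasure s \<delta> A + hausdorff_premeasure s \<delta> B + (ennreal (e / 2) + ennreal (e / 2))"
      by (simp add: ac_simps)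
    also have "ennreal (e / 2) + ennreal (e / 2) = ennreal e"
      using \<open>0 < e\<close> by (subst ennreal_plus[symmetric]) auto
    finally show "hausdorff_premeasure s \<delta> (A \<union> B)
      \<le> hausdorff_premeasure s \<delta> A + hausdorff_premeasure s \<delta> B + ennreal e" .
  qed
qed auto

lemma hausdorff_premeasure_UN:
  assumes "finite I" "0 \<le> \<delta>"
  shows "hausdorff_premeasure s \<delta> (\<Union>i\<in>I. A i) \<le> (\<Sum>i\<in>I. hausdorff_premeasure s \<delta> (A i))"
  using assms(1)
proof (induction I rule: finite_induct)
  case empty
  show ?case
    using hausdorff_premeasure_le_diam_pow[of "{}" \<delta> s] \<open>0 \<le> \<delta>\<close> by simp
next
  case (insert i I)
  have "hausdorff_premeasure s \<delta> (\<Union>j\<in>insert i I. A j)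
      \<le> hausdorff_premeasure s \<delta> (A i) + hausdorff_premeasure s \<delta> (\<Union>j\<in>I. A j)"
    using hausdorff_premeasure_Un[of s \<delta> "A i" "\<Union>j\<in>I. A j"] by simp
  also have "\<dots> \<le> hausdorff_premeasure s \<delta> (A i) + (\<Sum>j\<in>I. hausdorff_premeasure s \<delta> (A j))"
    using insert.IH by (intro add_left_mono)
  finally show ?case using insert.hyps by simp
qed

lemma bounded_Lipschitz_image:
  fixes f :: "'a::metric_space \<Rightarrow> 'b::metric_space"
  assumes "bounded A" and "\<And>x y. x \<in> A \<Longrightarrow> y \<in> A \<Longrightarrow> dist (f x) (f y) \<le> L * dist x y"
    and "0 \<le> L"
  shows "bounded (f ` A)" "diameter (f ` A) \<le> L * diameter A"
proof -
  have *: "dist (f x) (f y) \<le> L * diameter A" if "x \<in> A" "y \<in> A" for x y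
    using assms(2)[OF that] mult_left_mono[OF diameter_bounded_bound[OF assms(1) that] assms(3)]
    by simp
  then show "bounded (f ` A)"
    unfolding bounded_two_points by (intro exI[of _ "L * diameter A"]) auto
  show "diameter (f ` A) \<le> L * diameter A"
    using * diameter_ge_0[OF assms(1)] assms(3) by (intro diameter_le_dist) auto
qed

lemma hausdorff_premeasure_Lipschitz_image:
  fixes f :: "'a::metric_space \<Rightarrow> 'b::metric_space"
  assumes "0 < s" "0 < L" and L: "\<And>x y. x \<in> A \<Longrightarrow> y \<in> A \<Longrightarrow> dist (f x) (f y) \<le> L * dist x y"
  shows "hausdorff_premeasure s (L * \<delta>) (f ` A) \<le> ennreal (L powr s) * hausdorff_premeasure s \<delta> A"
proof -
  have "hausdorff_premeasure s (L * \<delta>) (f ` A) \<le> ennreal (L powr s) * (\<Sum>i. diam_pow s (U i))"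
    if U: "U \<in> delta_covers \<delta> A" for U
  proof -
    have b: "bounded (U i)" "diameter (U i) \<le> \<delta>" for i
      using U by (auto simp: delta_covers_def)
    \<comment> \<open>The map is controlled on \<open>A\<close> only, so each member is cut down to
      \<open>A\<close> before it is mapped.\<close>
    have b': "bounded (f ` (U i \<inter> A))" "diameter (f ` (U i \<inter> A)) \<le> L * diameter (U i)" for i
    proof -
      have bi: "bounded (U i \<inter> A)" using b(1) by (rule bounded_subset) auto
      show "bounded (f ` (U i \<inter> A))"
        using bi L \<open>0 < L\<close> by (intro bounded_Lipschitz_image[of _ f L]) auto
      have "diameter (f ` (U i \<inter> A)) \<le> L * diameter (U i \<inter> A)"
        using bi L \<open>0 < L\<close> by (intro bounded_Lipschitz_image(2)) auto
      also have "\<dots> \<le> L * diameter (U i)"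
        using \<open>0 < L\<close> by (intro mult_left_mono diameter_subset b) auto
      finally show "diameter (f ` (U i \<inter> A)) \<le> L * diameter (U i)" .
    qed
    have "A \<subseteq> (\<Union>i. U i)" using U by (auto simp: delta_covers_def)
    then have "f ` A \<subseteq> (\<Union>i. f ` (U i \<inter> A))" by blast
    moreover have "diameter (f ` (U i \<inter> A)) \<le> L * \<delta>" for i
      using b'(2)[of i] mult_left_mono[OF b(2)[of i], of L] \<open>0 < L\<close>
      by (simp add: less_imp_le order_trans)
    ultimately have "(\<lambda>i. f ` (U i \<inter> A)) \<in> delta_covers (L * \<delta>) (f ` A)"
      using b'(1) by (auto simp: delta_covers_def)
    then have "hausdorff_premeasure s (L * \<delta>) (f ` A) \<le> (\<Sum>i. diam_pow s (f ` (U i \<inter> A)))"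
      by (rule hausdorff_premeasure_le_cover)
    also have "\<dots> \<le> (\<Sum>i. ennreal (L powr s) * diam_pow s (U i))"
    proof (intro suminf_le summableI)
      fix i
      have "diameter (f ` (U i \<inter> A)) powr s \<le> (L * diameter (U i)) powr s"
        using b' \<open>0 < s\<close> diameter_ge_0 by (intro powr_mono2) auto
      then show "diam_pow s (f ` (U i \<inter> A)) \<le> ennreal (L powr s) * diam_pow s (U i)"
        using \<open>0 < s\<close> \<open>0 < L\<close> diameter_ge_0[OF b(1)[of i]]
        by (simp add: diam_pow_pos powr_mult ennreal_mult[symmetric] ennreal_leI)
    qed
    finally show ?thesis by simp
  qed
  then show ?thesis
    unfolding hausdorff_premeasure_def[of s \<delta> A] using \<open>0 < L\<close>
    by (intro le_ennreal_cmult_INF) auto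
qed

lemma hausdorff_premeasure_le_measure: "0 < \<delta> \<Longrightarrow> hausdorff_premeasure s \<delta> A \<le> hausdorff_measure s A"
  unfolding hausdorff_measure_eq_SUP by (intro SUP_upper) auto

lemma hausdorff_measure_Lipschitz_image:
  fixes f :: "'a::metric_space \<Rightarrow> 'b::metric_space"
  assumes "0 < s" "0 < L" and "\<And>x y. x \<in> A \<Longrightarrow> y \<in> A \<Longrightarrow> dist (f x) (f y) \<le> L * dist x y"
  shows "hausdorff_measure s (f ` A) \<le> ennreal (L powr s) * hausdorff_measure s A"
  unfolding hausdorff_measure_eq_SUP[of s "f ` A"]
proof (rule SUP_least)
  fix \<delta> :: real assume "\<delta> \<in> {0<..}"
  then have "hausdorff_premeasure s (L * (\<delta> / L)) (f ` A)
      \<le> ennreal (L powr s) * hausdorff_premeasure s (\<delta> / L) A"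
    by (intro hausdorff_premeasure_Lipschitz_image assms) auto
  also have "\<dots> \<le> ennreal (L powr s) * hausdorff_measure s A"
    using \<open>\<delta> \<in> {0<..}\<close> \<open>0 < L\<close>
    by (intro mult_left_mono hausdorff_premeasure_le_measure) auto
  finally show "hausdorff_premeasure s \<delta> (f ` A) \<le> ennreal (L powr s) * hausdorff_measure s A"
    using \<open>0 < L\<close> by simp
qed

lemma hausdorff_premeasure_exponent:
  assumes "0 < s" "s < s'" "0 < \<delta>"
  shows "hausdorff_premeasure s' \<delta> A \<le> ennreal (\<delta> powr (s' - s)) * hausdorff_premeasure s \<delta> A"
proof -
  have "hausdorff_premeasure s' \<delta> A \<le> ennreal (\<delta> powr (s' - s)) * (\<Sum>i. diam_pow s (U i))"
    if U: "U \<in> delta_covers \<delta> A" for U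
  proof -
    have "hausdorff_premeasure s' \<delta> A \<le> (\<Sum>i. diam_pow s' (U i))"
      using U by (rule hausdorff_premeasure_le_cover)
    also have "\<dots> \<le> (\<Sum>i. ennreal (\<delta> powr (s' - s)) * diam_pow s (U i))"
    proof (intro suminf_le summableI)
      fix i
      have d: "0 \<le> diameter (U i)" "diameter (U i) \<le> \<delta>"
        using U diameter_ge_0 by (auto simp: delta_covers_def)
      have "diameter (U i) powr s' = diameter (U i) powr (s' - s) * diameter (U i) powr s"
        by (simp flip: powr_add)
      also have "\<dots> \<le> \<delta> powr (s' - s) * diameter (U i) powr s"
        using d assms by (intro mult_right_mono powr_mono2) auto
      finally show "diam_pow s' (U i) \<le> ennreal (\<delta> powr (s' - s)) * diam_pow s (U i)"
        using assms by (simp add: diam_pow_pos ennreal_leI flip: ennreal_mult)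
    qed
    finally show ?thesis by simp
  qed
  then show ?thesis
    unfolding hausdorff_premeasure_def[of s \<delta> A] using assms
    by (intro le_ennreal_cmult_INF) auto
qed

text \<open>A finite \<open>s\<close>-measure \<open>h\<close> bounds the
  \<open>s'\<close>-premeasure at mesh \<delta> by \<open>\<delta> powr (s' - s) * h\<close>, which
  tends to 0.\<close>

lemma hausdorff_measure_eq_0_above:
  assumes "0 < s" "s < s'" "hausdorff_measure s A < \<infinity>"
  shows "hausdorff_measure s' A = 0"
proof -
  obtain h where h: "0 \<le> h" "hausdorff_measure s A = ennreal h"
    using assms(3) by (cases "hausdorff_measure s A") auto
  have "hausdorff_premeasure s' \<epsilon> A \<le> 0" if "0 < \<epsilon>" for \<epsilon>
  proof (rule tendsto_lowerbound)
    have "((\<lambda>\<delta>::real. \<delta> powr (s' - s)) \<longlongrightarrow> 0) (at_right 0)"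
      using tendsto_powr'[of "\<lambda>\<delta>::real. \<delta>" 0 "at_right 0" "\<lambda>_. s' - s" "s' - s"] assms
      gt_ex[of "0::real"] by (auto simp: eventually_at_right_field)
    then have "((\<lambda>\<delta>. ennreal (\<delta> powr (s' - s) * h)) \<longlongrightarrow> ennreal (0 * h)) (at_right 0)"
      by (intro tendsto_ennrealI tendsto_mult_right)
    then show "((\<lambda>\<delta>. ennreal (\<delta> powr (s' - s) * h)) \<longlongrightarrow> 0) (at_right 0)" by simp
    show "\<forall>\<^sub>F \<delta> in at_right 0. hausdorff_premeasure s' \<epsilon> A \<le> ennreal (\<delta> powr (s' - s) * h)"
    proof (rule eventually_at_rightI)
      fix \<delta> assume \<delta>: "\<delta> \<in> {0<..<\<epsilon>}"
      have "hausdorff_premeasure s' \<epsilon> A \<le> hausdorff_premeasure s' \<delta> A"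
        using \<delta> by (intro hausdorff_premeasure_antimono) auto
      also have "\<dots> \<le> ennreal (\<delta> powr (s' - s)) * hausdorff_premeasure s \<delta> A"
        using \<delta> assms by (intro hausdorff_premeasure_exponent) auto
      also have "\<dots> \<le> ennreal (\<delta> powr (s' - s)) * ennreal h"
        using \<delta> by (intro mult_left_mono) (auto simp flip: h(2) intro: hausdorff_premeasure_le_measure)
      finally show "hausdorff_premeasure s' \<epsilon> A \<le> ennreal (\<delta> powr (s' - s) * h)"
        using h(1) by (simp add: ennreal_mult)
    qed (use that in auto)
  qed auto
  then show ?thesis
    unfolding hausdorff_measure_eq_SUP by (intro antisym SUP_least) auto
qed

lemma hausdorff_measure_antimono_exponent:
  assumes "0 \<le> s'" "s' < s"
  shows "hausdorff_measure s A \<le> hausdorff_measure s' A"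
  unfolding hausdorff_measure_eq_SUP[of s]
proof (rule SUP_least)
  fix \<delta> :: real assume "\<delta> \<in> {0<..}"
  define \<epsilon> where "\<epsilon> = min \<delta> 1"
  have \<epsilon>: "0 < \<epsilon>" "\<epsilon> \<le> 1" "\<epsilon> \<le> \<delta>" using \<open>\<delta> \<in> {0<..}\<close> by (auto simp: \<epsilon>_def)
  have "hausdorff_premeasure s \<delta> A \<le> hausdorff_premeasure s \<epsilon> A"
    using \<epsilon> by (intro hausdorff_premeasure_antimono)
  also have "\<dots> \<le> hausdorff_premeasure s' \<epsilon> A"
    unfolding hausdorff_premeasure_def[of s' \<epsilon> A]
  proof (rule INF_greatest)
    fix U assume U: "U \<in> delta_covers \<epsilon> A"
    have "hausdorff_premeasure s \<epsilon> A \<le> (\<Sum>i. diam_pow s (U i))"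
      using U by (rule hausdorff_premeasure_le_cover)
    also have "\<dots> \<le> (\<Sum>i. diam_pow s' (U i))"
    proof (intro suminf_le summableI)
      fix i
      have d: "0 \<le> diameter (U i)" "diameter (U i) \<le> 1"
        using U diameter_ge_0 \<epsilon> by (auto simp: delta_covers_def intro: order_trans)
      have "diameter (U i) powr s \<le> diameter (U i) powr s'" if "s' > 0"
        using d assms that by (intro powr_mono') auto
      \<comment> \<open>This covers \<open>s' = 0\<close>, where \<open>diam_pow\<close> is 1 on
        nonempty sets; \<open>hausdorff_dim\<close> ranges over this exponent too.\<close>
      moreover have "diameter (U i) powr s \<le> 1"
        using d assms powr_mono2[of s "diameter (U i)" 1] by auto
      ultimately show "diam_pow s (U i) \<le> diam_pow s' (U i)"
        using assms by (auto simp: diam_pow_def ennreal_leI)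
    qed
    finally show "hausdorff_premeasure s \<epsilon> A \<le> (\<Sum>i. diam_pow s' (U i))" .
  qed
  also have "\<dots> \<le> hausdorff_measure s' A"
    using \<epsilon> by (intro hausdorff_premeasure_le_measure)
  finally show "hausdorff_premeasure s \<delta> A \<le> hausdorff_measure s' A" .
qed

lemma hausdorff_dim_eqI:
  assumes "0 < s" "0 < hausdorff_measure s A" "hausdorff_measure s A < \<infinity>"
  shows "hausdorff_dim A = ereal s"
  unfolding hausdorff_dim_def
proof (rule antisym)
  show "Inf {ereal t |t. 0 \<le> t \<and> hausdorff_measure t A = 0} \<le> ereal s"
  proof (rule ereal_le_epsilon2)
    fix e :: real assume "0 < e"
    then have "hausdorff_measure (s + e) A = 0"
      using assms by (intro hausdorff_measure_eq_0_above[of s]) auto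
    then show "Inf {ereal t |t. 0 \<le> t \<and> hausdorff_measure t A = 0} \<le> ereal s + ereal e"
      using \<open>0 < e\<close> assms by (intro Inf_lower) auto
  qed
  show "ereal s \<le> Inf {ereal t |t. 0 \<le> t \<and> hausdorff_measure t A = 0}"
  proof (rule Inf_greatest)
    fix x assume "x \<in> {ereal t |t. 0 \<le> t \<and> hausdorff_measure t A = 0}"
    then obtain t where t: "x = ereal t" "0 \<le> t" "hausdorff_measure t A = 0" by auto
    have "\<not> t < s"
      using hausdorff_measure_antimono_exponent[of t s A] t assms(2) by auto
    then show "ereal s \<le> x" using t by auto
  qed
qed

subsection \<open>Homogeneous self-similar sets\<close>

text \<open>The coding map of the system \<open>x \<mapsto> p z + r x\<close>. Labels and digit
  positions are kept apart so that one space of addresses serves all positions \<open>p\<close>,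
  which makes attractors for different \<open>p\<close> comparable.\<close>

definition digit_sum :: "real \<Rightarrow> ('i \<Rightarrow> 'a::euclidean_space) \<Rightarrow> (nat \<Rightarrow> 'i) \<Rightarrow> 'a" where
  "digit_sum r p \<omega> = (\<Sum>k. r ^ k *\<^sub>R p (\<omega> k))"

definition digit_set :: "real \<Rightarrow> 'i set \<Rightarrow> ('i \<Rightarrow> 'a::euclidean_space) \<Rightarrow> 'a set" where
  "digit_set r Z p = digit_sum r p ` {\<omega>. range \<omega> \<subseteq> Z}"

text \<open>\<open>dim_eq\<close> is the Moran equation for \<open>card Z\<close> maps of equal
  ratio. The digit positions \<open>p\<close> are not fixed here because they are going to move
  while \<open>r\<close>, \<open>s\<close> and \<open>Z\<close> stay.\<close>

locale digits =
  fixes r s :: real and Z :: "'i set"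
  assumes r: "0 < r" "r < 1" and s: "0 < s" and fin: "finite Z"
    and dim_eq: "real (card Z) * r powr s = 1"
begin

abbreviation "K \<equiv> digit_set r Z"

lemma nonempty: "Z \<noteq> {}"
  using dim_eq by auto

lemma card_pos: "0 < card Z"
  using nonempty fin by (simp add: card_gt_0_iff)

lemma ex_norm_le:
  fixes p :: "'i \<Rightarrow> 'a::euclidean_space"
  shows "\<exists>B. \<forall>z\<in>Z. norm (p z) \<le> B"
proof -
  have "bounded (p ` Z)" using fin by (intro finite_imp_bounded) auto
  then show ?thesis by (auto simp: bounded_iff)
qed

lemma summable_digits:
  fixes p :: "'i \<Rightarrow> 'a::euclidean_space"
  assumes "range \<omega> \<subseteq> Z"
  shows "summable (\<lambda>k. r ^ k *\<^sub>R p (\<omega> k))"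
proof -
  obtain B where B: "\<forall>z\<in>Z. norm (p z) \<le> B" using ex_norm_le by blast
  show ?thesis
  proof (rule summable_comparison_test')
    show "summable (\<lambda>k. B * r ^ k)" using r by (intro summable_mult summable_geometric) auto
    show "norm (r ^ k *\<^sub>R p (\<omega> k)) \<le> B * r ^ k" for k
      using B assms r by (auto simp: mult.commute intro!: mult_right_mono)
  qed
qed

lemma norm_suminf_digits:
  fixes v :: "nat \<Rightarrow> 'a::euclidean_space"
  assumes "\<And>k. norm (v k) \<le> B"
  shows "norm (\<Sum>k. r ^ k *\<^sub>R v k) \<le> B / (1 - r)"
proof -
  have *: "norm (r ^ k *\<^sub>R v k) \<le> B * r ^ k" for k
    using assms[of k] r by (auto simp: mult.commute intro!: mult_right_mono)
  have sB: "(\<lambda>k. B * r ^ k) sums (B * (1 / (1 - r)))"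
    using r by (intro sums_mult geometric_sums) auto
  have "summable (\<lambda>k. norm (r ^ k *\<^sub>R v k))"
    using * by (intro summable_comparison_test'[OF sums_summable[OF sB]]) auto
  then have "norm (\<Sum>k. r ^ k *\<^sub>R v k) \<le> (\<Sum>k. norm (r ^ k *\<^sub>R v k))"
    by (rule summable_norm)
  also have "\<dots> \<le> (\<Sum>k. B * r ^ k)"
    using * \<open>summable (\<lambda>k. norm (r ^ k *\<^sub>R v k))\<close> sums_summable[OF sB] by (intro suminf_le) auto
  also have "\<dots> = B / (1 - r)" using sums_unique[OF sB] by simp
  finally show ?thesis .
qed

lemma norm_digit_sum:
  fixes p :: "'i \<Rightarrow> 'a::euclidean_space"
  assumes "\<And>z. z \<in> Z \<Longrightarrow> norm (p z) \<le> B" "range \<omega> \<subseteq> Z"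
  shows "norm (digit_sum r p \<omega>) \<le> B / (1 - r)"
  unfolding digit_sum_def using assms by (intro norm_suminf_digits) auto

lemma digit_sum_Cons:
  fixes p :: "'i \<Rightarrow> 'a::euclidean_space"
  assumes "range \<omega> \<subseteq> Z"
  shows "digit_sum r p \<omega> = p (\<omega> 0) + r *\<^sub>R digit_sum r p (\<lambda>k. \<omega> (Suc k))"
proof -
  have "range (\<lambda>k. \<omega> (Suc k)) \<subseteq> Z" using assms by auto
  then have sm: "summable (\<lambda>k. r ^ k *\<^sub>R p (\<omega> (Suc k)))" by (rule summable_digits)
  have "digit_sum r p \<omega> = (\<Sum>k. r ^ Suc k *\<^sub>R p (\<omega> (Suc k))) + p (\<omega> 0)"
    unfolding digit_sum_def by (subst suminf_split_head[OF summable_digits[OF assms]]) simp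
  also have "(\<Sum>k. r ^ Suc k *\<^sub>R p (\<omega> (Suc k))) = r *\<^sub>R (\<Sum>k. r ^ k *\<^sub>R p (\<omega> (Suc k)))"
    using suminf_scaleR_right[OF sm, of r] by simp
  finally show ?thesis by (simp add: digit_sum_def add.commute)
qed

lemma K_self_similar:
  fixes p :: "'i \<Rightarrow> 'a::euclidean_space"
  shows "K p = (\<Union>z\<in>Z. (\<lambda>x. p z + r *\<^sub>R x) ` K p)"
proof (intro equalityI subsetI)
  fix x assume "x \<in> K p"
  then obtain \<omega> where \<omega>: "range \<omega> \<subseteq> Z" "x = digit_sum r p \<omega>" by (auto simp: digit_set_def)
  have "digit_sum r p (\<lambda>k. \<omega> (Suc k)) \<in> K p"
    using \<omega>(1) unfolding digit_set_def by (intro imageI) auto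
  then show "x \<in> (\<Union>z\<in>Z. (\<lambda>x. p z + r *\<^sub>R x) ` K p)"
    using digit_sum_Cons[OF \<omega>(1), of p] \<omega> by (intro UN_I[of "\<omega> 0"]) auto
next
  fix x assume "x \<in> (\<Union>z\<in>Z. (\<lambda>x. p z + r *\<^sub>R x) ` K p)"
  then obtain z \<omega> where z: "z \<in> Z" "range \<omega> \<subseteq> Z" "x = p z + r *\<^sub>R digit_sum r p \<omega>"
    by (auto simp: digit_set_def)
  have *: "range (case_nat z \<omega>) \<subseteq> Z" using z by (auto simp: image_subset_iff split: nat.splits)
  then have "x = digit_sum r p (case_nat z \<omega>)"
    using digit_sum_Cons[OF *, of p] z by simp
  then show "x \<in> K p" using * by (auto simp: digit_set_def)
qed

lemma piece_subset: "z \<in> Z \<Longrightarrow> x \<in> K p \<Longrightarrow> p z + r *\<^sub>R x \<in> K p"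
  by (subst K_self_similar) auto

lemma fixed_point_in_K:
  fixes p :: "'i \<Rightarrow> 'a::euclidean_space"
  assumes "z \<in> Z"
  shows "(1 / (1 - r)) *\<^sub>R p z \<in> K p"
proof -
  have "(\<lambda>k. r ^ k *\<^sub>R p z) sums ((1 / (1 - r)) *\<^sub>R p z)"
    using r by (intro sums_scaleR_left geometric_sums) auto
  then have "digit_sum r p (\<lambda>_. z) = (1 / (1 - r)) *\<^sub>R p z"
    unfolding digit_sum_def by (rule sums_unique[symmetric])
  then show ?thesis using assms unfolding digit_set_def by (auto intro!: image_eqI[of _ _ "\<lambda>_. z"])
qed

lemma K_nonempty: "K p \<noteq> {}"
  using fixed_point_in_K nonempty by blast

text \<open>The coding map is a uniform limit of continuous maps on a product of finite sets, which
  is compact by Tychonoff. The sequences consist of digit positions rather than labels, since the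
  label type carries no topology.\<close>

lemma compact_K:
  fixes p :: "'i \<Rightarrow> 'a::euclidean_space"
  shows "compact (K p)"
proof -
  define S where "S = (UNIV :: nat set) \<rightarrow>\<^sub>E p ` Z"
  obtain B where B: "\<forall>z\<in>Z. norm (p z) \<le> B" using ex_norm_le by blast
  have "compactin (product_topology (\<lambda>_. euclidean) (UNIV :: nat set)) S"
    unfolding S_def using fin by (auto simp: compactin_PiE intro: finite_imp_compact)
  then have "compact S" by (simp add: euclidean_product_topology)
  have "continuous_on S (\<lambda>v. \<Sum>k. r ^ k *\<^sub>R v k)"
  proof (rule uniform_limit_theorem)
    show "uniform_limit S (\<lambda>n v. \<Sum>k<n. r ^ k *\<^sub>R v k) (\<lambda>v. \<Sum>k. r ^ k *\<^sub>R v k) sequentially"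
    proof (rule Weierstrass_m_test)
      show "summable (\<lambda>k. B * r ^ k)" using r by (intro summable_mult summable_geometric) auto
      fix n v assume "v \<in> S"
      then have "v n \<in> p ` Z" by (auto simp: S_def)
      then show "norm (r ^ n *\<^sub>R v n) \<le> B * r ^ n"
        using B r by (auto simp: mult.commute intro!: mult_right_mono)
    qed
    show "\<forall>\<^sub>F n in sequentially. continuous_on S (\<lambda>v. \<Sum>k<n. r ^ k *\<^sub>R v k)"
      by (intro always_eventually allI continuous_intros
          continuous_on_subset[OF continuous_on_product_coordinates]) auto
  qed auto
  then have "compact ((\<lambda>v. \<Sum>k. r ^ k *\<^sub>R v k) ` S)"
    using \<open>compact S\<close> by (rule compact_continuous_image)
  also have "(\<lambda>v. \<Sum>k. r ^ k *\<^sub>R v k) ` S = K p"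
  proof (intro equalityI subsetI)
    fix x assume "x \<in> (\<lambda>v. \<Sum>k. r ^ k *\<^sub>R v k) ` S"
    then obtain v where v: "v \<in> S" "x = (\<Sum>k. r ^ k *\<^sub>R v k)" by auto
    then have "\<forall>k. \<exists>z\<in>Z. v k = p z" by (auto simp: S_def)
    then obtain \<omega> where "\<And>k. \<omega> k \<in> Z" "\<And>k. v k = p (\<omega> k)" by metis
    then show "x \<in> K p"
      using v by (auto simp: digit_set_def digit_sum_def intro!: image_eqI[of _ _ \<omega>])
  next
    fix x assume "x \<in> K p"
    then obtain \<omega> where "range \<omega> \<subseteq> Z" "x = digit_sum r p \<omega>" by (auto simp: digit_set_def)
    then show "x \<in> (\<lambda>v. \<Sum>k. r ^ k *\<^sub>R v k) ` S"
      by (auto simp: S_def digit_sum_def intro!: image_eqI[of _ _ "\<lambda>k. p (\<omega> k)"])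
  qed
  finally show ?thesis .
qed

lemma bounded_K: "bounded (K p)"
  by (intro compact_imp_bounded compact_K)

lemma diameter_K_nonneg: "0 \<le> diameter (K p)"
  by (intro diameter_ge_0 bounded_K)

lemma diameter_K_le:
  fixes p :: "'i \<Rightarrow> 'a::euclidean_space"
  assumes "\<And>z. z \<in> Z \<Longrightarrow> norm (p z) \<le> B"
  shows "diameter (K p) \<le> 2 * B / (1 - r)"
proof (rule diameter_le_dist)
  fix x y assume "x \<in> K p" "y \<in> K p"
  then have "norm x \<le> B / (1 - r)" "norm y \<le> B / (1 - r)"
    using norm_digit_sum[of p B] assms by (auto simp: digit_set_def)
  then show "dist x y \<le> 2 * B / (1 - r)"
    using norm_triangle_ineq4[of x y] by (simp add: dist_norm)
qed (use K_nonempty in auto)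

text \<open>Both pieces are translates of the same set \<open>r K\<close>, so the offset of the two
  points differs from \<open>p z - p z'\<close> by \<open>r (x - y)\<close> with \<open>x\<close>,
  \<open>y\<close> in \<open>K\<close>; hence only one diameter is lost.\<close>

lemma dist_pieces_ge:
  fixes p :: "'i \<Rightarrow> 'a::euclidean_space"
  assumes "x \<in> K p" "y \<in> K p"
  shows "dist (p z) (p z') - r * diameter (K p) \<le> dist (p z + r *\<^sub>R x) (p z' + r *\<^sub>R y)"
proof -
  have "dist (p z) (p z') \<le> norm ((p z + r *\<^sub>R x) - (p z' + r *\<^sub>R y)) + norm (r *\<^sub>R (x - y))"
    using norm_triangle_ineq4[of "(p z + r *\<^sub>R x) - (p z' + r *\<^sub>R y)" "r *\<^sub>R (x - y)"]
    by (simp add: dist_norm algebra_simps)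
  moreover have "norm (r *\<^sub>R (x - y)) \<le> r * diameter (K p)"
    using diameter_bounded_bound[OF bounded_K assms] r by (auto simp: dist_norm intro!: mult_left_mono)
  ultimately show ?thesis by (simp add: dist_norm)
qed

lemma ex_similitude_ifs:
  fixes p :: "'i \<Rightarrow> 'a::euclidean_space"
  assumes "\<And>z z'. z \<in> Z \<Longrightarrow> z' \<in> Z \<Longrightarrow> z \<noteq> z' \<Longrightarrow> r * diameter (K p) < dist (p z) (p z')"
  shows "\<exists>l \<phi>. similitude_ifs l \<phi> \<and> is_attractor l \<phi> (K p) \<and> strong_separation l \<phi> (K p)"
proof -
  obtain h where h: "bij_betw h {1..card Z} Z"
    using ex_bij_betw_nat_finite_1[OF fin] by blast
  define \<phi> where "\<phi> = (\<lambda>i x. p (h i) + r *\<^sub>R x)"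
  have "contracting_similitude (\<phi> i)" for i
    unfolding contracting_similitude_def \<phi>_def using r
    by (intro exI[of _ r]) (auto simp: dist_norm simp flip: scaleR_diff_right)
  then have 1: "similitude_ifs (card Z) \<phi>"
    using card_pos by (auto simp: similitude_ifs_def)
  define I where "I = {1..card Z}"
  have "(\<Union>i\<in>I. \<phi> i ` K p) = (\<Union>z\<in>h ` I. (\<lambda>x. p z + r *\<^sub>R x) ` K p)"
    by (simp only: \<phi>_def UN_simps)
  also have "h ` I = Z" unfolding I_def by (rule bij_betw_imp_surj_on[OF h])
  also have "(\<Union>z\<in>Z. (\<lambda>x. p z + r *\<^sub>R x) ` K p) = K p" by (rule K_self_similar[symmetric])
  finally have "K p = (\<Union>i\<in>{1..card Z}. \<phi> i ` K p)" unfolding I_def by (rule sym)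
  then have 2: "is_attractor (card Z) \<phi> (K p)"
    unfolding is_attractor_def using compact_K[of p] K_nonempty[of p] by (intro conjI)
  have "strong_separation (card Z) \<phi> (K p)"
    unfolding strong_separation_def
  proof (intro ballI impI)
    fix i j assume ij: "i \<in> {1..card Z}" "j \<in> {1..card Z}" "i \<noteq> j"
    then have "h i \<in> Z" "h j \<in> Z" "h i \<noteq> h j"
      using bij_betw_apply[OF h] inj_onD[OF bij_betw_imp_inj_on[OF h]] by blast+
    then have less: "r * diameter (K p) < dist (p (h i)) (p (h j))" by (rule assms)
    have False if "x \<in> K p" "y \<in> K p" "\<phi> i x = \<phi> j y" for x y
      using dist_pieces_ge[OF that(1,2), of "h i" "h j"] that(3) less by (simp add: \<phi>_def)
    then show "\<phi> i ` K p \<inter> \<phi> j ` K p = {}" by blast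
  qed
  with 1 2 show ?thesis by blast
qed

lemma hausdorff_premeasure_piece:
  fixes p :: "'i \<Rightarrow> 'a::euclidean_space"
  shows "hausdorff_premeasure s (r * \<delta>) ((\<lambda>x. p z + r *\<^sub>R x) ` A)
    \<le> ennreal (r powr s) * hausdorff_premeasure s \<delta> A"
  using r s by (intro hausdorff_premeasure_Lipschitz_image)
    (auto simp: dist_norm simp flip: scaleR_diff_right)

text \<open>No mesh condition is needed for covers of \<open>K\<close>, as covers can be pulled into the pieces.\<close>

lemma hausdorff_measure_K_le_premeasure:
  fixes p :: "'i \<Rightarrow> 'a::euclidean_space"
  assumes "0 < \<delta>"
  shows "hausdorff_measure s (K p) \<le> hausdorff_premeasure s \<delta> (K p)"
proof -
  \<comment> \<open>Copying a cover into all pieces multiplies the mesh by \<open>r\<close> and the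
    sum by \<open>card Z * r powr s = 1\<close>.\<close>
  have step: "hausdorff_premeasure s (r * \<delta>) (K p) \<le> hausdorff_premeasure s \<delta> (K p)" if "0 < \<delta>" for \<delta>
  proof -
    have "hausdorff_premeasure s (r * \<delta>) (K p)
        \<le> (\<Sum>z\<in>Z. hausdorff_premeasure s (r * \<delta>) ((\<lambda>x. p z + r *\<^sub>R x) ` K p))"
      using fin that r
      by (subst (1) K_self_similar) (intro hausdorff_premeasure_UN, auto)
    also have "\<dots> \<le> (\<Sum>z\<in>Z. ennreal (r powr s) * hausdorff_premeasure s \<delta> (K p))"
      by (intro sum_mono hausdorff_premeasure_piece)
    also have "\<dots> = ennreal (real (card Z) * r powr s) * hausdorff_premeasure s \<delta> (K p)"
      by (simp add: ennreal_mult ennreal_of_nat_eq_real_of_nat mult.assoc)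
    finally show ?thesis by (simp add: dim_eq)
  qed
  have iter: "hausdorff_premeasure s (r ^ n * \<delta>) (K p) \<le> hausdorff_premeasure s \<delta> (K p)" for n
  proof (induction n)
    case (Suc n)
    have "hausdorff_premeasure s (r ^ Suc n * \<delta>) (K p) \<le> hausdorff_premeasure s (r ^ n * \<delta>) (K p)"
      using step[of "r ^ n * \<delta>"] assms r by (simp add: mult.assoc)
    then show ?case using Suc by order
  qed auto
  show ?thesis
    unfolding hausdorff_measure_eq_SUP
  proof (rule SUP_least)
    fix \<epsilon> :: real assume "\<epsilon> \<in> {0<..}"
    then obtain n where "r ^ n < \<epsilon> / \<delta>"
      using real_arch_pow_inv[of "\<epsilon> / \<delta>" r] r assms by auto
    then have "r ^ n * \<delta> \<le> \<epsilon>" using assms by (simp add: field_simps)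
    then show "hausdorff_premeasure s \<epsilon> (K p) \<le> hausdorff_premeasure s \<delta> (K p)"
      using hausdorff_premeasure_antimono iter by (blast intro: order_trans)
  qed
qed

lemma hausdorff_measure_K_le: "hausdorff_measure s (K p) \<le> ennreal (diameter (K p) powr s)"
proof -
  have "hausdorff_measure s (K p) \<le> hausdorff_premeasure s (diameter (K p) + 1) (K p)"
    using diameter_K_nonneg[of p] by (intro hausdorff_measure_K_le_premeasure) auto
  also have "\<dots> \<le> diam_pow s (K p)"
    by (intro hausdorff_premeasure_le_diam_pow bounded_K) auto
  finally show ?thesis using s by (simp add: diam_pow_pos)
qed

section \<open>Lower bound for the measure by counting cylinders\<close>

primrec word_piece :: "('i \<Rightarrow> 'a::euclidean_space) \<Rightarrow> 'i list \<Rightarrow> 'a set" where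
  "word_piece p [] = K p"
| "word_piece p (z # w) = (\<lambda>x. p z + r *\<^sub>R x) ` word_piece p w"

lemma word_piece_subset: "set w \<subseteq> Z \<Longrightarrow> word_piece p w \<subseteq> K p"
  by (induction w) (auto intro: piece_subset)

lemma word_piece_nonempty: "word_piece p w \<noteq> {}"
  by (induction w) (auto simp: K_nonempty)

lemma diameter_word_piece:
  "bounded (word_piece p w) \<and> diameter (word_piece p w) \<le> r ^ length w * diameter (K p)"
proof (induction w)
  case (Cons z w)
  have "bounded ((\<lambda>x. p z + r *\<^sub>R x) ` word_piece p w)"
    "diameter ((\<lambda>x. p z + r *\<^sub>R x) ` word_piece p w) \<le> r * diameter (word_piece p w)"
    using Cons r by (auto intro!: bounded_Lipschitz_image simp: dist_norm simp flip: scaleR_diff_right)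
  moreover have "r * diameter (word_piece p w) \<le> r * (r ^ length w * diameter (K p))"
    using Cons r by (intro mult_left_mono) auto
  ultimately show ?case by (simp add: mult.assoc)
qed (simp add: bounded_K)

text \<open>A mass distribution principle in counting form: give every cylinder of level
  \<open>n\<close> the mass \<open>1 / N ^ n\<close>, \<open>N = card Z\<close>, and let only
  cylinders inside \<open>U\<close> count; then \<open>C * mass U \<le> |U| powr s\<close>. By
  induction on the level: with a single first letter, \<open>U\<close> can be blown up by
  \<open>1 / r\<close>; with several, \<open>sep\<close> settles the first level and the deeper
  letters are estimated trivially.\<close>

lemma card_words_in_set:
  fixes p :: "'i \<Rightarrow> 'a::euclidean_space"
  assumes C: "0 \<le> C" "C \<le> diameter (K p) powr s"
    and sep: "\<And>S. S \<subseteq> Z \<Longrightarrow> 2 \<le> card S \<Longrightarrow> r * diameter (K p) \<le> diameter (p ` S) \<and>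
      C * real (card S) \<le> real (card Z) * (diameter (p ` S) - r * diameter (K p)) powr s"
    and W: "W \<subseteq> {w. set w \<subseteq> Z \<and> length w = n}"
    and U: "bounded U" "(\<Union>w\<in>W. word_piece p w) \<subseteq> U"
  shows "C * real (card W) \<le> real (card Z) ^ n * diameter U powr s"
  using W U
proof (induction n arbitrary: W U)
  case 0
  then have "W = {} \<or> W = {[]}" by auto
  then show ?case
  proof
    assume "W = {[]}"
    then have "K p \<subseteq> U" using 0 by auto
    then have "diameter (K p) powr s \<le> diameter U powr s"
      using 0 s diameter_K_nonneg by (intro powr_mono2 diameter_subset) auto
    then show ?thesis using C \<open>W = {[]}\<close> by simp
  qed auto
next
  case (Suc n)
  have ne: "w \<noteq> []" if "w \<in> W" for w using that Suc.prems(1) by auto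
  have H: "hd ` W \<subseteq> Z" using Suc.prems(1) ne by (force dest: hd_in_set)
  have finW: "finite W"
    using Suc.prems(1) finite_lists_length_eq[OF fin] by (rule finite_subset)
  have pw: "p (hd w) + r *\<^sub>R x \<in> U" if "w \<in> W" "x \<in> word_piece p (tl w)" for w x
  proof -
    have "word_piece p w = (\<lambda>x. p (hd w) + r *\<^sub>R x) ` word_piece p (tl w)"
      using word_piece.simps(2)[of p "hd w" "tl w"] ne[OF that(1)] by simp
    then show ?thesis using that Suc.prems(3) by blast
  qed
  have tlW: "tl ` W \<subseteq> {w. set w \<subseteq> Z \<and> length w = n}"
    using Suc.prems(1) by (force dest: list.set_sel(2)[OF ne])
  consider "hd ` W = {}" | "card (hd ` W) = 1" | "2 \<le> card (hd ` W)"
    using finW by (cases "card (hd ` W)") (auto simp: not_less_eq_eq numeral_2_eq_2 Suc_le_eq)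
  then show ?case
  proof cases
    case 1
    then show ?thesis using diameter_ge_0[OF Suc.prems(2)] by auto
  next
    case 2
    then obtain z where z: "hd ` W = {z}" by (auto simp: card_1_singleton_iff)
    then have Wz: "w = z # tl w" if "w \<in> W" for w
      using that ne[OF that] by (metis imageI list.collapse singletonD)
    then have "inj_on tl W" by (metis inj_onI)
    \<comment> \<open>The preimage of \<open>U\<close> under the map with digit \<open>z\<close>. By
      \<open>dim_eq\<close>, the factor \<open>1 / r\<close> in the diameter becomes the factor
      \<open>card Z\<close> between the levels \<open>n\<close> and \<open>Suc n\<close>.\<close>
    define U' where "U' = (\<lambda>y. (1 / r) *\<^sub>R (y - p z)) ` U"
    have d: "dist ((1 / r) *\<^sub>R (x - p z)) ((1 / r) *\<^sub>R (y - p z)) \<le> (1 / r) * dist x y" for x y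
      using r by (simp add: dist_norm flip: scaleR_diff_right)
    have "0 \<le> 1 / r" using r by simp
    from bounded_Lipschitz_image[OF Suc.prems(2) d this]
    have U': "bounded U'" "diameter U' \<le> (1 / r) * diameter U"
      unfolding U'_def .
    have "(\<Union>w\<in>tl ` W. word_piece p w) \<subseteq> U'"
    proof clarsimp
      fix w x assume wx: "w \<in> W" "x \<in> word_piece p (tl w)"
      have "hd w = z" using wx z by auto
      then have "p z + r *\<^sub>R x \<in> U" using pw[OF wx] by simp
      then show "x \<in> U'" unfolding U'_def using r by (intro image_eqI) auto
    qed
    then have "C * real (card (tl ` W)) \<le> real (card Z) ^ n * diameter U' powr s"
      using tlW U'(1) by (intro Suc.IH)
    also have "\<dots> \<le> real (card Z) ^ n * ((1 / r) * diameter U) powr s"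
      using U' s diameter_ge_0 by (intro mult_left_mono powr_mono2) auto
    also have "((1 / r) * diameter U) powr s = real (card Z) * diameter U powr s"
      using dim_eq r diameter_ge_0[OF Suc.prems(2)]
      by (simp add: powr_divide powr_mult field_simps)
    finally show ?thesis using \<open>inj_on tl W\<close> by (simp add: card_image mult_ac)
  next
    case 3
    \<comment> \<open>A lower bound for the diameter of \<open>U\<close>: two words whose first
      letters realise the diameter of the digits contribute points of \<open>U\<close> at least this
      far apart.\<close>
    define D where "D = diameter (p ` hd ` W) - r * diameter (K p)"
    have "W \<noteq> {}" using 3 by auto
    then obtain w w' where w: "w \<in> W" "w' \<in> W" "dist (p (hd w)) (p (hd w')) = diameter (p ` hd ` W)"
      using diameter_compact_attained[of "p ` hd ` W"] finW by (auto simp: finite_imp_compact)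
    obtain x x' where x: "x \<in> word_piece p (tl w)" "x' \<in> word_piece p (tl w')"
      using word_piece_nonempty by blast
    have xK: "x \<in> K p" "x' \<in> K p"
      using x w tlW word_piece_subset by blast+
    have "D \<le> dist (p (hd w) + r *\<^sub>R x) (p (hd w') + r *\<^sub>R x')"
      using dist_pieces_ge[OF xK, of "hd w" "hd w'"] w(3) by (simp add: D_def)
    also have "\<dots> \<le> diameter U"
      using pw w x by (intro diameter_bounded_bound Suc.prems(2)) auto
    finally have "D \<le> diameter U" .
    have *: "0 \<le> D" "C * real (card (hd ` W)) \<le> real (card Z) * D powr s"
      using sep[OF H 3] by (auto simp: D_def)
    \<comment> \<open>Every continuation of an occurring first letter is counted as if it were in
      \<open>W\<close>.\<close>
    have "W \<subseteq> (\<lambda>(z, w). z # w) ` (hd ` W \<times> {w. set w \<subseteq> Z \<and> length w = n})"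
    proof
      fix w assume "w \<in> W"
      then show "w \<in> (\<lambda>(z, w). z # w) ` (hd ` W \<times> {w. set w \<subseteq> Z \<and> length w = n})"
        using tlW ne by (intro image_eqI[of _ _ "(hd w, tl w)"]) auto
    qed
    then have "card W \<le> card (hd ` W \<times> {w. set w \<subseteq> Z \<and> length w = n})"
      using finW finite_lists_length_eq[OF fin, of n] by (intro surj_card_le) auto
    also have "\<dots> = card (hd ` W) * card Z ^ n"
      by (simp add: card_cartesian_product card_lists_length_eq[OF fin])
    finally have "C * real (card W) \<le> C * real (card (hd ` W) * card Z ^ n)"
      using C by (intro mult_left_mono of_nat_mono)
    also have "\<dots> = C * real (card (hd ` W)) * real (card Z) ^ n" by simp
    also have "\<dots> \<le> real (card Z) * D powr s * real (card Z) ^ n"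
      using * by (intro mult_right_mono) auto
    also have "\<dots> \<le> real (card Z) * diameter U powr s * real (card Z) ^ n"
      using * \<open>D \<le> diameter U\<close> s by (intro mult_right_mono mult_left_mono powr_mono2) auto
    finally show ?thesis by (simp add: mult_ac)
  qed
qed

end

text \<open>Provides the open covers that compactness of \<open>K\<close> needs. Enlarging by a
  small \<eta> costs little, since \<open>(|U| + 2 * \<eta>) powr s\<close> tends to
  \<open>|U| powr s\<close>, also for \<open>|U| = 0\<close> as \<open>s > 0\<close>.\<close>

lemma open_thickening:
  fixes U :: "'a::euclidean_space set"
  assumes "bounded U" "0 < s" "0 < e"
  obtains V where "open V" "bounded V" "U \<subseteq> V" "diameter V powr s \<le> diameter U powr s + e"
proof -
  have d: "0 \<le> diameter U" using assms(1) by (rule diameter_ge_0)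
  have "((\<lambda>\<eta>. (diameter U + 2 * \<eta>) powr s) \<longlongrightarrow> (diameter U + 2 * 0) powr s) (at_right 0)"
    using assms(2) d
    by (intro tendsto_powr' tendsto_intros) (auto simp: eventually_at_right_field intro!: exI[of _ 1])
  then have "\<forall>\<^sub>F \<eta> in at_right 0. (diameter U + 2 * \<eta>) powr s < diameter U powr s + e"
    using assms(3) by (intro order_tendstoD(2)) auto
  then obtain b where b: "0 < b" "\<And>\<eta>. 0 < \<eta> \<Longrightarrow> \<eta> < b \<Longrightarrow> (diameter U + 2 * \<eta>) powr s < diameter U powr s + e"
    by (auto simp: eventually_at_right_field)
  define \<eta> where "\<eta> = b / 2"
  have \<eta>: "0 < \<eta>" "(diameter U + 2 * \<eta>) powr s < diameter U powr s + e"
    using b(1) b(2)[of \<eta>] by (simp_all add: \<eta>_def)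
  define V where "V = (\<Union>x\<in>U. ball x \<eta>)"
  have dist: "dist x y \<le> diameter U + 2 * \<eta>" if xy: "x \<in> V" "y \<in> V" for x y
  proof -
    obtain x' y' where *: "x' \<in> U" "y' \<in> U" "dist x' x < \<eta>" "dist y' y < \<eta>"
      using xy by (auto simp: V_def)
    have "dist x' y' \<le> diameter U" using diameter_bounded_bound[OF assms(1) *(1,2)] .
    then show ?thesis
      using * dist_triangle[of x y x'] dist_triangle[of x' y y'] by (simp add: dist_commute)
  qed
  have "bounded V" unfolding bounded_two_points using dist by blast
  have "diameter V \<le> diameter U + 2 * \<eta>"
    using dist d \<eta> by (intro diameter_le_dist) auto
  then have "diameter V powr s \<le> (diameter U + 2 * \<eta>) powr s"
    using assms(2) diameter_ge_0[OF \<open>bounded V\<close>] by (intro powr_mono2) auto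
  then show ?thesis
    using \<eta> \<open>bounded V\<close> by (intro that[of V]) (auto simp: V_def)
qed

context digits
begin

text \<open>An arbitrary cover is enlarged to an open one at total cost \<open>e\<close>. By its
  Lebesgue number, each cylinder of a deep level lies in a single member, and
  \<open>card_words_in_set\<close> summed over the members gives \<open>C\<close>.\<close>

lemma hausdorff_measure_K_ge:
  fixes p :: "'i \<Rightarrow> 'a::euclidean_space"
  assumes C: "0 \<le> C" "C \<le> diameter (K p) powr s"
    and sep: "\<And>S. S \<subseteq> Z \<Longrightarrow> 2 \<le> card S \<Longrightarrow> r * diameter (K p) \<le> diameter (p ` S) \<and>
      C * real (card S) \<le> real (card Z) * (diameter (p ` S) - r * diameter (K p)) powr s"
  shows "ennreal C \<le> hausdorff_measure s (K p)"
proof -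
  have "ennreal C \<le> hausdorff_premeasure s 1 (K p)"
    unfolding hausdorff_premeasure_def
  proof (rule INF_greatest, rule ennreal_le_epsilon)
    fix U and e :: real assume U: "U \<in> delta_covers 1 (K p)" and "0 < e"
    have bU: "bounded (U i)" for i using U by (auto simp: delta_covers_def)
    have "\<exists>V. open V \<and> bounded V \<and> U i \<subseteq> V \<and> diameter V powr s \<le> diameter (U i) powr s + e * (1/2) ^ Suc i" for i
      using open_thickening[OF bU s, of "e * (1/2) ^ Suc i" i] \<open>0 < e\<close> by (metis half_gt_zero mult_pos_pos zero_less_divide_1_iff zero_less_numeral zero_less_power)
    then obtain V where V: "\<And>i. open (V i)" "\<And>i. bounded (V i)" "\<And>i. U i \<subseteq> V i"
      "\<And>i. diameter (V i) powr s \<le> diameter (U i) powr s + e * (1/2) ^ Suc i" by metis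
    have "K p \<subseteq> \<Union> (range V)" using U V(3) by (force simp: delta_covers_def)
    then obtain \<epsilon> where \<epsilon>: "0 < \<epsilon>" "\<And>x. x \<in> K p \<Longrightarrow> \<exists>G\<in>range V. ball x \<epsilon> \<subseteq> G"
      using Heine_Borel_lemma[OF compact_K, of p "range V"] V(1) by blast
    obtain n where n: "r ^ n < \<epsilon> / (diameter (K p) + 1)"
      using real_arch_pow_inv[of "\<epsilon> / (diameter (K p) + 1)" r] r \<epsilon>(1) diameter_K_nonneg[of p] by auto
    have "r ^ n * diameter (K p) \<le> r ^ n * (diameter (K p) + 1)"
      using r by (intro mult_left_mono) auto
    also have "\<dots> < \<epsilon>" using n diameter_K_nonneg[of p] by (simp add: field_simps)
    finally have small: "r ^ n * diameter (K p) < \<epsilon>" .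
    define W where "W = {w. set w \<subseteq> Z \<and> length w = n}"
    have finW: "finite W" and cardW: "card W = card Z ^ n"
      using finite_lists_length_eq[OF fin] card_lists_length_eq[OF fin] by (auto simp: W_def)
    have "\<exists>i. word_piece p w \<subseteq> V i" if "w \<in> W" for w
    proof -
      obtain x where x: "x \<in> word_piece p w" using word_piece_nonempty by blast
      then have "x \<in> K p" using word_piece_subset that by (auto simp: W_def)
      then obtain i where i: "ball x \<epsilon> \<subseteq> V i" using \<epsilon>(2) by blast
      have "dist x y < \<epsilon>" if "y \<in> word_piece p w" for y
      proof -
        have "dist x y \<le> diameter (word_piece p w)"
          using x that diameter_word_piece by (intro diameter_bounded_bound) auto
        also have "\<dots> \<le> r ^ n * diameter (K p)"
          using diameter_word_piece[of p w] \<open>w \<in> W\<close> by (auto simp: W_def)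
        finally show ?thesis using small by simp
      qed
      then show ?thesis using i by (intro exI[of _ i]) auto
    qed
    \<comment> \<open>Each cylinder is assigned to just one member, so the sets of words per member
      partition \<open>W\<close> and their sizes add up to \<open>card Z ^ n\<close>.\<close>
    then obtain i where i: "\<And>w. w \<in> W \<Longrightarrow> word_piece p w \<subseteq> V (i w)" by metis
    have N: "0 < real (card Z) ^ n" using card_pos by simp
    have "C * real (card Z) ^ n = (\<Sum>w\<in>W. C)" by (simp add: cardW)
    also have "\<dots> = (\<Sum>j\<in>i ` W. \<Sum>w\<in>{w\<in>W. i w = j}. C)"
      using finW by (intro sum.image_gen)
    also have "\<dots> = (\<Sum>j\<in>i ` W. C * real (card {w\<in>W. i w = j}))" by (simp add: mult.commute)
    also have "\<dots> \<le> (\<Sum>j\<in>i ` W. real (card Z) ^ n * diameter (V j) powr s)"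
    proof (rule sum_mono, rule card_words_in_set[OF C sep])
      fix j
      show "{w \<in> W. i w = j} \<subseteq> {w. set w \<subseteq> Z \<and> length w = n}" by (auto simp: W_def)
      show "(\<Union>w\<in>{w \<in> W. i w = j}. word_piece p w) \<subseteq> V j" using i by auto
    qed (use V in auto)
    also have "\<dots> = (\<Sum>j\<in>i ` W. diameter (V j) powr s) * real (card Z) ^ n"
      by (simp add: sum_distrib_left mult.commute)
    finally have "C \<le> (\<Sum>j\<in>i ` W. diameter (V j) powr s)" using N by simp
    also have "\<dots> \<le> (\<Sum>j\<in>i ` W. diameter (U j) powr s + e * (1/2) ^ Suc j)"
      by (intro sum_mono V(4))
    finally have "ennreal C \<le> ennreal (\<Sum>j\<in>i ` W. diameter (U j) powr s + e * (1/2) ^ Suc j)"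
      by (rule ennreal_leI)
    also have "\<dots> = (\<Sum>j\<in>i ` W. diam_pow s (U j) + ennreal (e * (1/2) ^ Suc j))"
      using \<open>0 < e\<close> s by (subst sum_ennreal[symmetric]) (auto simp: diam_pow_pos ennreal_plus)
    also have "\<dots> \<le> (\<Sum>j. diam_pow s (U j) + ennreal (e * (1/2) ^ Suc j))"
      using finW by (intro sum_le_suminf summableI) auto
    also have "\<dots> = (\<Sum>j. diam_pow s (U j)) + (\<Sum>j. ennreal (e * (1/2) ^ Suc j))"
      by (intro suminf_add[symmetric] summableI)
    also have "(\<Sum>j. ennreal (e * (1/2) ^ Suc j)) = ennreal e"
    proof (rule sums_unique[symmetric])
      have "(\<lambda>j. e * (1/2) ^ Suc j) sums (e * 1)"
        by (intro sums_mult power_half_series)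
      then show "(\<lambda>j. ennreal (e * (1/2) ^ Suc j)) sums ennreal e"
        using \<open>0 < e\<close> by (subst sums_ennreal) auto
    qed
    finally show "ennreal C \<le> (\<Sum>j. diam_pow s (U j)) + ennreal e" .
  qed
  also have "\<dots> \<le> hausdorff_measure s (K p)" by (intro hausdorff_premeasure_le_measure) auto
  finally show ?thesis .
qed

end

subsection \<open>Continuity under perturbation of the digits\<close>

context digits
begin

lemma card_ge_2: "2 \<le> card Z"
proof (rule ccontr)
  assume "\<not> 2 \<le> card Z"
  then have "r powr s = 1" using card_pos dim_eq by (cases "card Z = 1") auto
  moreover have "r powr s < 1" using r s powr_less_mono2[of s r 1] by auto
  ultimately show False by simp
qed

text \<open>The fixed points \<open>p z / (1 - r)\<close> of the maps lie in \<open>K\<close> and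
  are at least as far apart as the digits.\<close>

lemma diameter_K_ge:
  fixes p :: "'i \<Rightarrow> 'a::euclidean_space"
  assumes "z \<in> Z" "z' \<in> Z"
  shows "dist (p z) (p z') \<le> diameter (K p)"
proof -
  have "dist (p z) (p z') \<le> (1 / (1 - r)) * dist (p z) (p z')"
    using r mult_right_mono[of 1 "1 / (1 - r)" "dist (p z) (p z')"] by simp
  also have "\<dots> = dist ((1 / (1 - r)) *\<^sub>R p z) ((1 / (1 - r)) *\<^sub>R p z')"
    using r by (simp add: dist_norm flip: scaleR_diff_right)
  also have "\<dots> \<le> diameter (K p)"
    using assms by (intro diameter_bounded_bound bounded_K fixed_point_in_K)
  finally show ?thesis .
qed

lemma digit_sum_diff:
  fixes p :: "'i \<Rightarrow> 'a::euclidean_space"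
  assumes "range \<omega> \<subseteq> Z"
  shows "digit_sum r p' \<omega> - digit_sum r p \<omega> = digit_sum r (\<lambda>z. p' z - p z) \<omega>"
  unfolding digit_sum_def
  by (simp add: suminf_diff[OF summable_digits[OF assms] summable_digits[OF assms]] scaleR_diff_right)

text \<open>
  After cancelling the common prefix of two addresses, the points are at distance at least \<open>g\<close>, so
  an additive perturbation of the digits costs only a multiplicative factor.
\<close>

lemma dist_digit_sum_perturb:
  fixes p p' :: "'i \<Rightarrow> 'a::euclidean_space"
  assumes g: "0 < g"
    and sep: "\<And>z z'. z \<in> Z \<Longrightarrow> z' \<in> Z \<Longrightarrow> z \<noteq> z' \<Longrightarrow> g \<le> dist (p z) (p z') - r * diameter (K p)"
    and \<eta>: "\<And>z. z \<in> Z \<Longrightarrow> norm (p' z - p z) \<le> \<eta>"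
    and \<omega>: "range \<omega> \<subseteq> Z" "range \<omega>' \<subseteq> Z"
  shows "dist (digit_sum r p' \<omega>) (digit_sum r p' \<omega>')
    \<le> (1 + 2 * \<eta> / ((1 - r) * g)) * dist (digit_sum r p \<omega>) (digit_sum r p \<omega>')"
proof (cases "\<omega> = \<omega>'")
  case False
  have "0 \<le> \<eta>" using \<eta> nonempty norm_ge_zero order_trans by blast
  define L where "L = 1 + 2 * \<eta> / ((1 - r) * g)"
  have main: "dist (digit_sum r p' \<omega>) (digit_sum r p' \<omega>') \<le> L * dist (digit_sum r p \<omega>) (digit_sum r p \<omega>')"
    if "\<forall>k<n. \<omega> k = \<omega>' k" "\<omega> n \<noteq> \<omega>' n" "range \<omega> \<subseteq> Z" "range \<omega>' \<subseteq> Z" for n \<omega> \<omega>'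
    using that
  proof (induction n arbitrary: \<omega> \<omega>')
    case 0
    have tails: "digit_sum r p (\<lambda>k. \<omega> (Suc k)) \<in> K p" "digit_sum r p (\<lambda>k. \<omega>' (Suc k)) \<in> K p"
      using 0(3,4) unfolding digit_set_def by (auto intro!: imageI)
    have "g \<le> dist (p (\<omega> 0)) (p (\<omega>' 0)) - r * diameter (K p)" using 0 by (intro sep) auto
    also have "\<dots> \<le> dist (digit_sum r p \<omega>) (digit_sum r p \<omega>')"
      unfolding digit_sum_Cons[OF 0(3), of p] digit_sum_Cons[OF 0(4), of p]
      by (rule dist_pieces_ge[OF tails])
    finally have ge: "g \<le> dist (digit_sum r p \<omega>) (digit_sum r p \<omega>')" .
    \<comment> \<open>\<open>digit_sum\<close> is linear in the digits, so each endpoint moves by a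
      digit sum of vectors of norm at most \<eta>; the two endpoints give the factor 2.\<close>
    have "norm (digit_sum r p' \<omega> - digit_sum r p \<omega>) \<le> \<eta> / (1 - r)"
      "norm (digit_sum r p' \<omega>' - digit_sum r p \<omega>') \<le> \<eta> / (1 - r)"
      using 0 \<eta> by (auto simp: digit_sum_diff intro!: norm_digit_sum)
    then have "dist (digit_sum r p' \<omega>) (digit_sum r p' \<omega>')
        \<le> dist (digit_sum r p \<omega>) (digit_sum r p \<omega>') + 2 * \<eta> / (1 - r)"
      using norm_triangle_ineq[of "digit_sum r p \<omega> - digit_sum r p \<omega>'"
          "(digit_sum r p' \<omega> - digit_sum r p \<omega>) - (digit_sum r p' \<omega>' - digit_sum r p \<omega>')"]
        norm_triangle_ineq4[of "digit_sum r p' \<omega> - digit_sum r p \<omega>" "digit_sum r p' \<omega>' - digit_sum r p \<omega>'"]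
      by (simp add: dist_norm)
    also have "2 * \<eta> / (1 - r) = 2 * \<eta> / ((1 - r) * g) * g" using g by simp
    also have "\<dots> \<le> 2 * \<eta> / ((1 - r) * g) * dist (digit_sum r p \<omega>) (digit_sum r p \<omega>')"
      using ge g r \<open>0 \<le> \<eta>\<close> by (intro mult_left_mono divide_nonneg_pos) auto
    finally show ?case by (simp add: L_def algebra_simps)
  next
    case (Suc n)
    have eq: "dist (digit_sum r q \<omega>) (digit_sum r q \<omega>')
      = r * dist (digit_sum r q (\<lambda>k. \<omega> (Suc k))) (digit_sum r q (\<lambda>k. \<omega>' (Suc k)))"
      for q :: "'i \<Rightarrow> 'a"
      using Suc.prems(1) r digit_sum_Cons[OF Suc.prems(3), of q] digit_sum_Cons[OF Suc.prems(4), of q]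
      by (simp add: dist_norm flip: scaleR_diff_right)
    have "dist (digit_sum r p' (\<lambda>k. \<omega> (Suc k))) (digit_sum r p' (\<lambda>k. \<omega>' (Suc k)))
      \<le> L * dist (digit_sum r p (\<lambda>k. \<omega> (Suc k))) (digit_sum r p (\<lambda>k. \<omega>' (Suc k)))"
      using Suc.prems by (intro Suc.IH) auto
    then show ?case using r by (simp add: eq mult.left_commute mult_left_mono)
  qed
  define n where "n = (LEAST n. \<omega> n \<noteq> \<omega>' n)"
  have "\<exists>n. \<omega> n \<noteq> \<omega>' n" using False by auto
  then have "\<omega> n \<noteq> \<omega>' n" "\<forall>k<n. \<omega> k = \<omega>' k"
    unfolding n_def by (rule LeastI_ex) (auto dest: not_less_Least)
  then show ?thesis using main \<omega> unfolding L_def by blast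
qed auto

text \<open>The map sends a point to the point with the same address in the other system. For fixed
  \<open>g\<close> its Lipschitz constant tends to 1 as \<eta> tends to 0.\<close>

lemma K_perturb_Lipschitz:
  fixes p p' :: "'i \<Rightarrow> 'a::euclidean_space"
  assumes g: "0 < g"
    and sep: "\<And>z z'. z \<in> Z \<Longrightarrow> z' \<in> Z \<Longrightarrow> z \<noteq> z' \<Longrightarrow> g \<le> dist (p z) (p z') - r * diameter (K p)"
    and \<eta>: "\<And>z. z \<in> Z \<Longrightarrow> norm (p' z - p z) \<le> \<eta>"
  obtains f where "K p' = f ` K p"
    "\<And>x y. x \<in> K p \<Longrightarrow> y \<in> K p \<Longrightarrow> dist (f x) (f y) \<le> (1 + 2 * \<eta> / ((1 - r) * g)) * dist x y"
proof -
  define \<Omega> where "\<Omega> = {\<omega> :: nat \<Rightarrow> 'i. range \<omega> \<subseteq> Z}"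
  define f where "f x = digit_sum r p' (inv_into \<Omega> (digit_sum r p) x)" for x
  have K_eq: "K q = digit_sum r q ` \<Omega>" for q :: "'i \<Rightarrow> 'a" by (simp add: digit_set_def \<Omega>_def)
  have *: "dist (digit_sum r p' \<omega>) (digit_sum r p' \<omega>')
    \<le> (1 + 2 * \<eta> / ((1 - r) * g)) * dist (digit_sum r p \<omega>) (digit_sum r p \<omega>')"
    if "\<omega> \<in> \<Omega>" "\<omega>' \<in> \<Omega>" for \<omega> \<omega>'
    using that by (intro dist_digit_sum_perturb g sep \<eta>) (auto simp: \<Omega>_def)
  have inv: "inv_into \<Omega> (digit_sum r p) x \<in> \<Omega>" "digit_sum r p (inv_into \<Omega> (digit_sum r p) x) = x"
    if "x \<in> K p" for x
    using that unfolding K_eq by (rule inv_into_into, rule f_inv_into_f)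
  \<comment> \<open>Independence of the address picked by \<open>inv_into\<close>: two addresses of
    one point have distance 0 for \<open>p\<close>, hence by the Lipschitz estimate also for
    \<open>p'\<close>.\<close>
  have "f (digit_sum r p \<omega>) = digit_sum r p' \<omega>" if "\<omega> \<in> \<Omega>" for \<omega>
  proof -
    have "digit_sum r p \<omega> \<in> K p" using that by (auto simp: K_eq)
    from *[OF inv(1)[OF this] that] inv(2)[OF this] show ?thesis by (simp add: f_def)
  qed
  then have "K p' = f ` K p" by (force simp: K_eq image_image)
  moreover have "dist (f x) (f y) \<le> (1 + 2 * \<eta> / ((1 - r) * g)) * dist x y"
    if "x \<in> K p" "y \<in> K p" for x y
    using *[OF inv(1)[OF that(1)] inv(1)[OF that(2)]] by (simp add: f_def inv(2) that)
  ultimately show ?thesis by (rule that)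
qed

text \<open>\<open>enn2real\<close> loses nothing, since the measure is at most
  \<open>|K| powr s\<close>. If \<open>|K| = 0\<close>, the division by 0 gives 0, so a positive
  value forces \<open>|K| > 0\<close>.\<close>

definition rel_measure :: "('i \<Rightarrow> 'a::euclidean_space) \<Rightarrow> real" where
  "rel_measure p = enn2real (hausdorff_measure s (K p)) / diameter (K p) powr s"

lemma hausdorff_measure_K_eq: "hausdorff_measure s (K p) = ennreal (enn2real (hausdorff_measure s (K p)))"
  using le_less_trans[OF hausdorff_measure_K_le ennreal_less_top, of p] by simp

lemma rel_measure_le_1: "rel_measure p \<le> 1"
proof -
  have "enn2real (hausdorff_measure s (K p)) \<le> diameter (K p) powr s"
    using hausdorff_measure_K_le[of p] by (intro enn2real_leI) auto
  then show ?thesis by (simp add: rel_measure_def divide_le_eq_1)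
qed

text \<open>One factor \<open>L powr s\<close> comes from the measure under the map from
  \<open>K p\<close> to \<open>K p'\<close>, the other from the diameter under the map back; this is
  why both systems are assumed separated.\<close>

lemma rel_measure_perturb:
  fixes p p' :: "'i \<Rightarrow> 'a::euclidean_space"
  assumes g: "0 < g"
    and sep: "\<And>z z'. z \<in> Z \<Longrightarrow> z' \<in> Z \<Longrightarrow> z \<noteq> z' \<Longrightarrow> g \<le> dist (p z) (p z') - r * diameter (K p)"
      "\<And>z z'. z \<in> Z \<Longrightarrow> z' \<in> Z \<Longrightarrow> z \<noteq> z' \<Longrightarrow> g \<le> dist (p' z) (p' z') - r * diameter (K p')"
    and \<eta>: "\<And>z. z \<in> Z \<Longrightarrow> norm (p' z - p z) \<le> \<eta>"
  shows "rel_measure p' \<le> (1 + 2 * \<eta> / ((1 - r) * g)) powr (2 * s) * rel_measure p"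
proof -
  define L where "L = 1 + 2 * \<eta> / ((1 - r) * g)"
  have "0 \<le> \<eta>" using \<eta> nonempty norm_ge_zero order_trans by blast
  then have L: "0 < L" using r g by (auto simp: L_def intro!: add_pos_nonneg divide_nonneg_pos)
  obtain f where f: "K p' = f ` K p" "\<And>x y. x \<in> K p \<Longrightarrow> y \<in> K p \<Longrightarrow> dist (f x) (f y) \<le> L * dist x y"
    using K_perturb_Lipschitz[of g p p' \<eta>] g sep(1) \<eta> unfolding L_def by metis
  have "\<And>z. z \<in> Z \<Longrightarrow> norm (p z - p' z) \<le> \<eta>" using \<eta> by (simp add: norm_minus_commute)
  then obtain f' where f': "K p = f' ` K p'"
    "\<And>x y. x \<in> K p' \<Longrightarrow> y \<in> K p' \<Longrightarrow> dist (f' x) (f' y) \<le> L * dist x y"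
    using K_perturb_Lipschitz[of g p' p \<eta>] g sep(2) unfolding L_def by metis
  have "diameter (K p) \<le> L * diameter (K p')"
    using f' L bounded_K[of p'] by (subst f'(1)) (intro bounded_Lipschitz_image(2), auto)
  then have D: "diameter (K p) powr s \<le> L powr s * diameter (K p') powr s"
    using L s diameter_K_nonneg[of p] diameter_K_nonneg[of p']
    by (simp add: powr_mono2 flip: powr_mult)
  have "hausdorff_measure s (K p') \<le> ennreal (L powr s) * hausdorff_measure s (K p)"
    using f L s by (subst f(1)) (intro hausdorff_measure_Lipschitz_image, auto)
  then have "ennreal (enn2real (hausdorff_measure s (K p')))
      \<le> ennreal (L powr s * enn2real (hausdorff_measure s (K p)))"
    by (subst (asm) (1 2) hausdorff_measure_K_eq) (simp add: ennreal_mult)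
  then have H: "enn2real (hausdorff_measure s (K p')) \<le> L powr s * enn2real (hausdorff_measure s (K p))"
    by (simp add: ennreal_le_iff)
  have pos: "0 < diameter (K q) powr s" if
    "\<And>z z'. z \<in> Z \<Longrightarrow> z' \<in> Z \<Longrightarrow> z \<noteq> z' \<Longrightarrow> g \<le> dist (q z) (q z') - r * diameter (K q)"
    for q :: "'i \<Rightarrow> 'a"
  proof -
    obtain z z' where z: "z \<in> Z" "z' \<in> Z" "z \<noteq> z'"
      using card_ge_2 card_le_Suc0_iff_eq[OF fin] by force
    have "0 < dist (q z) (q z')"
      using that[OF z] g r diameter_K_nonneg[of q] mult_nonneg_nonneg[of r "diameter (K q)"] by linarith
    then have "0 < diameter (K q)" using diameter_K_ge[OF z(1,2), of q] by linarith
    then show ?thesis by simp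
  qed
  have "rel_measure p' \<le> L powr s * enn2real (hausdorff_measure s (K p)) / diameter (K p') powr s"
    unfolding rel_measure_def using H by (intro divide_right_mono) auto
  also have "\<dots> \<le> L powr s * enn2real (hausdorff_measure s (K p)) * (L powr s / diameter (K p) powr s)"
    unfolding divide_inverse[of "L powr s * _"]
    using D pos[OF sep(1)] pos[OF sep(2)] L by (intro mult_left_mono) (auto simp: field_simps)
  also have "\<dots> = L powr (2 * s) * rel_measure p"
    using powr_add[of L s s] by (simp add: rel_measure_def)
  finally show ?thesis by (simp add: L_def)
qed

text \<open>With one gap \<open>g\<close> for the whole path, \<open>rel_measure_perturb\<close>
  bounds the quotient of the values at \<open>t'\<close> and \<open>t\<close> by a function
  \<open>h\<close> of \<open>t' - t\<close> alone, with \<open>h 0 = 1\<close>.\<close>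

lemma rel_measure_intermediate_value:
  fixes p :: "real \<Rightarrow> 'i \<Rightarrow> 'a::euclidean_space"
  assumes g: "0 < g" and "a \<le> b" "0 \<le> M"
    and sep: "\<And>t z z'. a \<le> t \<Longrightarrow> t \<le> b \<Longrightarrow> z \<in> Z \<Longrightarrow> z' \<in> Z \<Longrightarrow> z \<noteq> z' \<Longrightarrow>
      g \<le> dist (p t z) (p t z') - r * diameter (K (p t))"
    and M: "\<And>t t' z. z \<in> Z \<Longrightarrow> norm (p t' z - p t z) \<le> M * \<bar>t' - t\<bar>"
    and c: "rel_measure (p b) \<le> c" "c \<le> rel_measure (p a)"
  obtains t where "a \<le> t" "t \<le> b" "rel_measure (p t) = c"
proof -
  define C where "C = 2 * M / ((1 - r) * g)"
  define h where "h x = (1 + C * \<bar>x\<bar>) powr (2 * s)" for x :: real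
  have C: "0 \<le> C" using r g \<open>0 \<le> M\<close> by (auto simp: C_def intro!: divide_nonneg_pos)
  have le: "rel_measure (p t') \<le> h (t' - t) * rel_measure (p t)" if "t \<in> {a..b}" "t' \<in> {a..b}" for t t'
  proof -
    have "rel_measure (p t') \<le> (1 + 2 * (M * \<bar>t' - t\<bar>) / ((1 - r) * g)) powr (2 * s) * rel_measure (p t)"
      using that by (intro rel_measure_perturb g sep M) auto
    then show ?thesis by (simp add: h_def C_def mult_ac)
  qed
  have h1: "1 \<le> h x" for x using C s by (auto simp: h_def intro!: ge_one_powr_ge_zero)
  have diff: "rel_measure (p t') - rel_measure (p t) \<le> h (t' - t) - 1" if "t \<in> {a..b}" "t' \<in> {a..b}" for t t'
  proof -
    \<comment> \<open>As the values are at most 1, the multiplicative bound becomes an additive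
      modulus of continuity.\<close>
    have "(h (t' - t) - 1) * rel_measure (p t) \<le> (h (t' - t) - 1) * 1"
      using h1 rel_measure_le_1 by (intro mult_left_mono) auto
    then show ?thesis using le[OF that] by (simp add: algebra_simps)
  qed
  have "continuous_on {a..b} (\<lambda>t. rel_measure (p t))"
    unfolding continuous_on_def
  proof
    fix t assume t: "t \<in> {a..b}"
    have "((\<lambda>t'. h (t' - t) - 1) \<longlongrightarrow> (1 + C * \<bar>t - t\<bar>) powr (2 * s) - 1) (at t within {a..b})"
      unfolding h_def using C by (intro tendsto_intros) auto
    then have lim: "((\<lambda>t'. h (t' - t) - 1) \<longlongrightarrow> 0) (at t within {a..b})" by simp
    have "((\<lambda>t'. rel_measure (p t') - rel_measure (p t)) \<longlongrightarrow> 0) (at t within {a..b})"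
    proof (rule Lim_null_comparison[OF _ lim])
      show "\<forall>\<^sub>F t' in at t within {a..b}. norm (rel_measure (p t') - rel_measure (p t)) \<le> h (t' - t) - 1"
        unfolding eventually_at_filter
      proof (intro always_eventually allI impI)
        fix t' assume "t' \<in> {a..b}"
        then show "norm (rel_measure (p t') - rel_measure (p t)) \<le> h (t' - t) - 1"
          using diff[OF t, of t'] diff[of t' t] t by (auto simp: h_def abs_minus_commute abs_le_iff)
      qed
    qed
    then show "((\<lambda>t'. rel_measure (p t')) \<longlongrightarrow> rel_measure (p t)) (at t within {a..b})"
      by (simp add: LIM_zero_iff)
  qed
  then show ?thesis
    using IVT2'[of "\<lambda>t. rel_measure (p t)" b c a] c \<open>a \<le> b\<close> that by blast
qed

lemma K_solves:
  fixes p :: "'i \<Rightarrow> 'a::euclidean_space"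
  assumes "\<And>z z'. z \<in> Z \<Longrightarrow> z' \<in> Z \<Longrightarrow> z \<noteq> z' \<Longrightarrow> r * diameter (K p) < dist (p z) (p z')"
    and "rel_measure p = c" "0 < c"
  shows "(\<exists>l \<phi>. similitude_ifs l \<phi> \<and> is_attractor l \<phi> (K p) \<and> strong_separation l \<phi> (K p)) \<and>
    hausdorff_dim (K p) = ereal s \<and> hausdorff_measure s (K p) = ennreal (c * diameter (K p) powr s)"
proof (intro conjI)
  have "diameter (K p) powr s \<noteq> 0" using assms(2,3) by (auto simp: rel_measure_def)
  then have "enn2real (hausdorff_measure s (K p)) = c * diameter (K p) powr s"
    unfolding assms(2)[symmetric] rel_measure_def by (metis nonzero_divide_eq_eq)
  moreover have pos: "0 < c * diameter (K p) powr s"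
    using assms(3) \<open>diameter (K p) powr s \<noteq> 0\<close> by simp
  ultimately show eq: "hausdorff_measure s (K p) = ennreal (c * diameter (K p) powr s)"
    using hausdorff_measure_K_eq[of p] by simp
  show "hausdorff_dim (K p) = ereal s"
    using eq s pos by (intro hausdorff_dim_eqI) auto
  show "\<exists>l \<phi>. similitude_ifs l \<phi> \<and> is_attractor l \<phi> (K p) \<and> strong_separation l \<phi> (K p)"
    by (rule ex_similitude_ifs) (rule assms(1))
qed

text \<open>Two sets cover \<open>K\<close>: the piece of \<open>z0\<close> and the union of all
  others, which lies in a ball of radius \<rho> plus the reach \<open>r * B / (1 - r)\<close> of a
  piece. Such a coarse cover is admissible by
  \<open>hausdorff_measure_K_le_premeasure\<close>.\<close>

lemma hausdorff_measure_K_cluster: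
  fixes p :: "'i \<Rightarrow> 'a::euclidean_space"
  assumes "z0 \<in> Z" and \<rho>: "\<And>z. z \<in> Z \<Longrightarrow> z \<noteq> z0 \<Longrightarrow> norm (p z) \<le> \<rho>"
    and B: "\<And>z. z \<in> Z \<Longrightarrow> norm (p z) \<le> B"
  shows "hausdorff_measure s (K p)
    \<le> ennreal ((2 * (\<rho> + r * B / (1 - r))) powr s + r powr s * diameter (K p) powr s)"
proof -
  define E where "E = (\<Union>z\<in>Z - {z0}. (\<lambda>x. p z + r *\<^sub>R x) ` K p)"
  define P where "P = (\<lambda>x. p z0 + r *\<^sub>R x) ` K p"
  have KE: "K p = E \<union> P"
    using assms(1) unfolding E_def P_def by (subst K_self_similar) auto
  have nE: "norm x \<le> \<rho> + r * B / (1 - r)" if "x \<in> E" for x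
  proof -
    obtain z y where zy: "z \<in> Z" "z \<noteq> z0" "y \<in> K p" "x = p z + r *\<^sub>R y"
      using \<open>x \<in> E\<close> by (auto simp: E_def)
    have "norm y \<le> B / (1 - r)"
      using zy(3) norm_digit_sum[of p B] B by (auto simp: digit_set_def)
    then have "norm (r *\<^sub>R y) \<le> r * (B / (1 - r))"
      using r mult_left_mono[of "norm y" "B / (1 - r)" r] by simp
    then show ?thesis using zy \<rho>[OF zy(1,2)] norm_triangle_ineq[of "p z" "r *\<^sub>R y"] by simp
  qed
  then have bE: "bounded E" by (auto simp: bounded_iff)
  have "Z - {z0} \<noteq> {}" using card_ge_2 card_mono[of "{z0}" Z] by auto
  then have "E \<noteq> {}" using K_nonempty[of p] by (auto simp: E_def)
  then have dE: "diameter E \<le> 2 * (\<rho> + r * B / (1 - r))"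
  proof (intro diameter_le_dist disjI1)
    fix x y assume xy: "x \<in> E" "y \<in> E"
    show "dist x y \<le> 2 * (\<rho> + r * B / (1 - r))"
      unfolding dist_norm mult_2
      by (rule order_trans[OF norm_triangle_ineq4 add_mono[OF nE[OF xy(1)] nE[OF xy(2)]]])
  qed
  have bP: "bounded P" "diameter P \<le> r * diameter (K p)"
    unfolding P_def using r
    by (intro bounded_Lipschitz_image[OF bounded_K, of _ "\<lambda>x. p z0 + r *\<^sub>R x" r];
        simp add: dist_norm flip: scaleR_diff_right)+
  define \<delta> where "\<delta> = max 1 (max (diameter E) (diameter P))"
  have "hausdorff_measure s (K p) \<le> hausdorff_premeasure s \<delta> (K p)"
    by (intro hausdorff_measure_K_le_premeasure) (auto simp: \<delta>_def)
  also have "\<dots> \<le> hausdorff_premeasure s \<delta> E + hausdorff_premeasure s \<delta> P"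
    by (subst KE) (rule hausdorff_premeasure_Un)
  also have "\<dots> \<le> diam_pow s E + diam_pow s P"
    using bE bP by (intro add_mono hausdorff_premeasure_le_diam_pow) (auto simp: \<delta>_def)
  also have "\<dots> = ennreal (diameter E powr s + diameter P powr s)"
    using s by (simp add: diam_pow_pos ennreal_plus)
  also have "\<dots> \<le> ennreal ((2 * (\<rho> + r * B / (1 - r))) powr s + (r * diameter (K p)) powr s)"
    using dE bP bE s by (intro ennreal_leI add_mono powr_mono2 diameter_ge_0) auto
  finally show ?thesis using r diameter_K_nonneg[of p] by (simp add: powr_mult)
qed

end

subsection \<open>The isodiametric inequality for lattice points\<close>

text \<open>The translates of \<open>X\<close> by \<open>Min Y\<close> and of \<open>Y\<close> by
  \<open>Max X + 1\<close> are disjoint. Without the shift by 1 they would share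
  \<open>Max X + Min Y\<close>, the usual loss of one; the \<open>e\<close> comes from adding
  intervals \<open>[0,1]\<close> to the integer points.\<close>

lemma card_sumset_int:
  fixes X Y :: "int set"
  assumes "finite X" "finite Y" "X \<noteq> {}" "Y \<noteq> {}"
  shows "card X + card Y \<le> card {x + y + e |x y e. x \<in> X \<and> y \<in> Y \<and> e \<in> {0, 1}}"
proof -
  define S where "S = {x + y + e |x y e. x \<in> X \<and> y \<in> Y \<and> e \<in> {0, 1}}"
  define X' where "X' = (\<lambda>x. x + Min Y) ` X"
  define Y' where "Y' = (\<lambda>y. Max X + y + 1) ` Y"
  have "S \<subseteq> (\<lambda>(x, y, e). x + y + e) ` (X \<times> Y \<times> {0, 1})" by (force simp: S_def)
  then have "finite S" by (rule finite_subset) (use assms in auto)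
  have "X' \<subseteq> S"
    unfolding X'_def S_def using Min_in[OF assms(2,4)] by force
  moreover have "Y' \<subseteq> S"
    unfolding Y'_def S_def using Max_in[OF assms(1,3)] by force
  moreover have "X' \<inter> Y' = {}"
  proof -
    have "x + Min Y \<noteq> Max X + y + 1" if "x \<in> X" "y \<in> Y" for x y
      using Max_ge[OF assms(1) that(1)] Min_le[OF assms(2) that(2)] by linarith
    then show ?thesis by (auto simp: X'_def Y'_def)
  qed
  moreover have "card X' = card X" "card Y' = card Y"
    by (auto simp: X'_def Y'_def inj_on_def intro!: card_image)
  ultimately have "card X + card Y \<le> card S"
    using card_mono[OF \<open>finite S\<close>, of "X' \<union> Y'"] card_Un_disjoint[of X' Y'] assms(1,2)
    by (simp add: X'_def Y'_def)
  then show ?thesis by (simp add: S_def)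
qed

text \<open>Layer cake formula: a natural number counts the levels \<open>k \<ge> 1\<close> that do
  not exceed it.\<close>

lemma sum_eq_sum_card_level:
  fixes f :: "'a \<Rightarrow> nat"
  assumes "finite X" "\<And>x. x \<in> X \<Longrightarrow> f x \<le> m"
  shows "sum f X = (\<Sum>k=1..m. card {x \<in> X. k \<le> f x})"
proof -
  have "sum f X = (\<Sum>x\<in>X. \<Sum>k=1..m. if k \<le> f x then 1 else 0)"
  proof (rule sum.cong)
    fix x assume "x \<in> X"
    have "(\<Sum>k=1..m. if k \<le> f x then 1 else 0) = card {k \<in> {1..m}. k \<le> f x}"
      by (simp add: sum.If_cases Int_def)
    also have "{k \<in> {1..m}. k \<le> f x} = {1..f x}" using assms(2)[OF \<open>x \<in> X\<close>] by auto
    finally show "f x = (\<Sum>k=1..m. if k \<le> f x then 1 else 0)" by simp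
  qed simp
  also have "\<dots> = (\<Sum>k=1..m. \<Sum>x\<in>X. if k \<le> f x then 1 else 0)" by (rule sum.swap)
  also have "\<dots> = (\<Sum>k=1..m. card {x \<in> X. k \<le> f x})"
    using assms(1) by (simp add: sum.If_cases Int_def)
  finally show ?thesis .
qed

text \<open>For a real function the integer levels see at most the floor, hence only an
  inequality.\<close>

lemma sum_card_level_le:
  fixes h :: "'a \<Rightarrow> real"
  assumes "finite X" "\<And>x. x \<in> X \<Longrightarrow> 0 \<le> h x"
  shows "real (\<Sum>k=1..m. card {x \<in> X. real k \<le> h x}) \<le> sum h X"
proof -
  have "(\<Sum>k=1..m. card {x \<in> X. real k \<le> h x}) = (\<Sum>k=1..m. \<Sum>x\<in>X. if real k \<le> h x then 1 else 0)"
    using assms(1) by (simp add: sum.If_cases Int_def)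
  also have "\<dots> = (\<Sum>x\<in>X. \<Sum>k=1..m. if real k \<le> h x then 1 else 0)" by (rule sum.swap)
  also have "real \<dots> \<le> sum h X"
    unfolding of_nat_sum
  proof (rule sum_mono)
    fix x assume "x \<in> X"
    have "(\<Sum>k=1..m. if real k \<le> h x then 1 else 0 :: nat) = card {k \<in> {1..m}. real k \<le> h x}"
      by (simp add: sum.If_cases Int_def)
    also have "\<dots> \<le> card {1..nat \<lfloor>h x\<rfloor>}"
      by (intro card_mono) (auto simp: le_nat_floor)
    finally have "(\<Sum>k=1..m. if real k \<le> h x then 1 else 0 :: nat) \<le> nat \<lfloor>h x\<rfloor>" by simp
    then have "real (\<Sum>k=1..m. if real k \<le> h x then 1 else 0) \<le> real (nat \<lfloor>h x\<rfloor>)" by linarith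
    then show "(\<Sum>k=1..m. real (if real k \<le> h x then 1 else 0)) \<le> h x"
      using of_nat_floor[OF assms(2)[OF \<open>x \<in> X\<close>]] by (simp add: of_nat_sum)
  qed
  finally show ?thesis .
qed

text \<open>A discrete Prekopa--Leindler inequality, by comparing superlevel sets.\<close>

lemma sum_add_sum_le_sum_of_min_le:
  fixes f g :: "int \<Rightarrow> nat" and h :: "int \<Rightarrow> real"
  assumes fin: "finite X" "finite Y" "finite U"
    and m: "\<And>x. x \<in> X \<Longrightarrow> f x \<le> m" "\<And>y. y \<in> Y \<Longrightarrow> g y \<le> m"
    and max: "\<exists>x\<in>X. f x = m" "\<exists>y\<in>Y. g y = m"
    and h: "\<And>x y e. x \<in> X \<Longrightarrow> y \<in> Y \<Longrightarrow> e \<in> {0, 1} \<Longrightarrow> real (min (f x) (g y)) \<le> h (x + y + e)"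
    and U: "\<And>u. u \<in> U \<Longrightarrow> 0 \<le> h u" "\<And>u. 0 < h u \<Longrightarrow> u \<in> U"
  shows "real (sum f X + sum g Y) \<le> sum h U"
proof -
  have "sum f X + sum g Y = (\<Sum>k=1..m. card {x \<in> X. k \<le> f x} + card {y \<in> Y. k \<le> g y})"
    using fin m by (simp add: sum_eq_sum_card_level[of _ _ m] sum.distrib)
  also have "\<dots> \<le> (\<Sum>k=1..m. card {u \<in> U. real k \<le> h u})"
  proof (rule sum_mono)
    fix k assume k: "k \<in> {1..m}"
    define F where "F = {x \<in> X. k \<le> f x}"
    define G where "G = {y \<in> Y. k \<le> g y}"
    \<comment> \<open>The common maximum \<open>m\<close> makes both superlevel sets nonempty for
      every \<open>k \<le> m\<close>, as the sumset bound requires.\<close>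
    have "card F + card G \<le> card {x + y + e |x y e. x \<in> F \<and> y \<in> G \<and> e \<in> {0, 1}}"
      using fin max k by (intro card_sumset_int) (auto simp: F_def G_def)
    also have "\<dots> \<le> card {u \<in> U. real k \<le> h u}"
    proof (intro card_mono subsetI)
      fix u assume "u \<in> {x + y + e |x y e. x \<in> F \<and> y \<in> G \<and> e \<in> {0, 1}}"
      then obtain x y e where u: "u = x + y + e" "x \<in> F" "y \<in> G" "e \<in> {0, 1}" by blast
      then have "k \<le> min (f x) (g y)" "real (min (f x) (g y)) \<le> h u"
        using h[of x y e] by (auto simp: F_def G_def)
      then have "real k \<le> h u" by linarith
      then show "u \<in> {u \<in> U. real k \<le> h u}" using U(2)[of u] k by auto
    qed (use fin in auto)
    finally show "card {x \<in> X. k \<le> f x} + card {y \<in> Y. k \<le> g y} \<le> card {u \<in> U. real k \<le> h u}"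
      by (simp add: F_def G_def)
  qed
  finally have "real (sum f X + sum g Y) \<le> real (\<Sum>k=1..m. card {u \<in> U. real k \<le> h u})"
    by linarith
  also have "\<dots> \<le> sum h U" using fin U by (intro sum_card_level_le) auto
  finally show ?thesis .
qed

section \<open>Brunn-Minkowski for lattice sets, by induction on the coordinates\<close>

definition cube :: "'n set \<Rightarrow> ('n \<Rightarrow> int) set" where
  "cube I = {e. (\<forall>i\<in>I. e i \<in> {0, 1}) \<and> (\<forall>i. i \<notin> I \<longrightarrow> e i = 0)}"

definition cube_sum :: "'n set \<Rightarrow> ('n \<Rightarrow> int) set \<Rightarrow> ('n \<Rightarrow> int) set \<Rightarrow> ('n \<Rightarrow> int) set" where
  "cube_sum I A B = (\<lambda>(a, b, e) i. a i + b i + e i) ` (A \<times> B \<times> cube I)"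

lemma finite_cube: "finite (cube (I :: 'n::finite set))"
proof -
  have "cube I \<subseteq> (UNIV :: 'n set) \<rightarrow>\<^sub>E {0, 1}" by (auto simp: cube_def)
  then show ?thesis by (rule finite_subset) (auto intro!: finite_PiE)
qed

lemma finite_cube_sum: "finite A \<Longrightarrow> finite B \<Longrightarrow> finite (cube_sum (I :: 'n::finite set) A B)"
  by (simp add: cube_sum_def finite_cube)

text \<open>Coordinate \<open>i\<close> is reset to 0 rather than dropped, so vectors stay functions
  on the whole index type and the induction in \<open>card_cube_sum\<close> only shrinks their
  support.\<close>

definition slice :: "'n \<Rightarrow> ('n \<Rightarrow> int) set \<Rightarrow> int \<Rightarrow> ('n \<Rightarrow> int) set" where
  "slice i A t = (\<lambda>x. x(i := 0)) ` {x \<in> A. x i = t}"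

lemma card_slice: "card (slice i A t) = card {x \<in> A. x i = t}"
  unfolding slice_def by (intro card_image inj_onI) (auto simp: fun_eq_iff split: if_splits, metis)

lemma card_eq_sum_slice:
  assumes "finite A"
  shows "card A = (\<Sum>t\<in>(\<lambda>x. x i) ` A. card (slice i A t))"
proof -
  have "card A = (\<Sum>x\<in>A. 1)" by simp
  also have "\<dots> = (\<Sum>t\<in>(\<lambda>x. x i) ` A. \<Sum>x\<in>{x \<in> A. x i = t}. 1)"
    using assms by (intro sum.image_gen)
  finally show ?thesis by (simp add: card_slice)
qed

text \<open>A vector of \<open>cube I\<close> vanishes at \<open>i\<close> and may be given the
  value \<open>e\<close> there; so both heights \<open>x + y\<close> and \<open>x + y + 1\<close>
  carry a copy of the sumset of the two slices.\<close>

lemma cube_sum_slice_subset: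
  assumes "i \<notin> I" "e \<in> {0, 1}"
  shows "cube_sum I (slice i A x) (slice i B y) \<subseteq> slice i (cube_sum (insert i I) A B) (x + y + e)"
proof
  fix w assume "w \<in> cube_sum I (slice i A x) (slice i B y)"
  then obtain a b c where abc: "a \<in> A" "a i = x" "b \<in> B" "b i = y" "c \<in> cube I"
    "w = (\<lambda>j. (a(i := 0)) j + (b(i := 0)) j + c j)"
    by (auto simp: cube_sum_def slice_def)
  have c: "c(i := e) \<in> cube (insert i I)" "c i = 0"
    using abc(5) assms by (auto simp: cube_def)
  define v where "v = (\<lambda>j. a j + b j + (c(i := e)) j)"
  have "v \<in> cube_sum (insert i I) A B"
    using abc c unfolding cube_sum_def v_def by (intro image_eqI[of _ _ "(a, b, c(i := e))"]) auto
  moreover have "v i = x + y + e" using abc by (simp add: v_def)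
  moreover have "w = v(i := 0)" using abc c by (auto simp: v_def fun_eq_iff)
  ultimately show "w \<in> slice i (cube_sum (insert i I) A B) (x + y + e)"
    by (auto simp: slice_def)
qed

text \<open>
  A multiplicative Brunn--Minkowski inequality for unions of lattice cubes: the sets
  \<open>A + [0,1]\<^sup>n\<close> and \<open>B + [0,1]\<^sup>n\<close> have sum \<open>A + B + {0,1}\<^sup>n + [0,1]\<^sup>n\<close>.
\<close>

lemma card_cube_sum:
  fixes I :: "'n::finite set"
  assumes "finite A" "finite B" "\<And>a i. a \<in> A \<Longrightarrow> i \<notin> I \<Longrightarrow> a i = 0" "\<And>b i. b \<in> B \<Longrightarrow> i \<notin> I \<Longrightarrow> b i = 0"
  shows "4 ^ card I * card A * card B \<le> card (cube_sum I A B) ^ 2"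
  using finite[of I] assms
proof (induction I arbitrary: A B rule: finite_induct)
  case empty
  have le1: "card S \<le> 1" if "\<And>a i. a \<in> S \<Longrightarrow> a i = 0" for S :: "('n \<Rightarrow> int) set"
  proof -
    have "S \<subseteq> {\<lambda>_. 0}" using that by auto
    then show ?thesis using card_mono[of "{\<lambda>_::'n. 0::int}" S] by simp
  qed
  show ?case
  proof (cases "A = {} \<or> B = {}")
    case False
    then have "cube_sum {} A B \<noteq> {}" by (auto simp: cube_sum_def cube_def)
    then have "1 \<le> card (cube_sum {} A B) ^ 2"
      using finite_cube_sum[OF empty(1,2), of "{}"] by (simp add: Suc_le_eq card_gt_0_iff)
    moreover have "card A * card B \<le> 1 * 1"
      using empty le1[of A] le1[of B] by (intro mult_le_mono) auto
    ultimately show ?thesis by simp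
  qed auto
next
  case (insert i I)
  show ?case
  proof (cases "A = {} \<or> B = {}")
    case False
    define C where "C = cube_sum (insert i I) A B"
    define X where "X = (\<lambda>x. x i) ` A"
    define Y where "Y = (\<lambda>x. x i) ` B"
    define f where "f t = card (slice i A t)" for t
    define g where "g t = card (slice i B t)" for t
    \<comment> \<open>Sizes of the largest slices. The functions \<open>G * f\<close> and
      \<open>F * g\<close> have the same maximum \<open>F * G\<close>, so the one-dimensional
      inequality applies to them.\<close>
    define F where "F = Max (f ` X)"
    define G where "G = Max (g ` Y)"
    have fin: "finite C" "finite X" "finite Y"
      using insert.prems finite_cube_sum by (auto simp: C_def X_def Y_def)
    have ne: "X \<noteq> {}" "Y \<noteq> {}" using False by (auto simp: X_def Y_def)
    have F: "f x \<le> F" if "x \<in> X" for x using that fin by (auto simp: F_def)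
    have G: "g x \<le> G" if "x \<in> Y" for x using that fin by (auto simp: G_def)
    have exF: "\<exists>x\<in>X. f x = F" 
    proof -
      have "F \<in> f ` X" unfolding F_def using fin ne by (intro Max_in) auto
      then show ?thesis by auto
    qed
    have exG: "\<exists>x\<in>Y. g x = G" 
    proof -
      have "G \<in> g ` Y" unfolding G_def using fin ne by (intro Max_in) auto
      then show ?thesis by auto
    qed
    have "0 < f x" if "x \<in> X" for x
      using that insert.prems(1) by (auto simp: f_def X_def card_slice card_gt_0_iff)
    then have Fpos: "0 < F" using exF by auto
    have "0 < g x" if "x \<in> Y" for x
      using that insert.prems(2) by (auto simp: g_def Y_def card_slice card_gt_0_iff)
    then have Gpos: "0 < G" using exG by auto
    have slices: "4 ^ card I * f x * g y \<le> card (slice i C (x + y + e)) ^ 2" if "e \<in> {0, 1}" for x y e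
    proof -
      have "4 ^ card I * f x * g y \<le> card (cube_sum I (slice i A x) (slice i B y)) ^ 2"
        unfolding f_def g_def using insert.prems
        by (intro insert.IH) (auto simp: slice_def)
      also have "\<dots> \<le> card (slice i C (x + y + e)) ^ 2"
        unfolding C_def using cube_sum_slice_subset[OF insert.hyps(2) that] fin(1)
        by (intro power_mono card_mono) (auto simp: slice_def C_def)
      finally show ?thesis .
    qed
    \<comment> \<open>The constant with \<open>min (G * f x) (F * g y) \<le> sqrt (F * G) * sqrt (f
      x * g y) \<le> \<kappa> * card (slice i C (x + y + e))\<close>; the second inequality is
      \<open>slices\<close>.\<close>
    define \<kappa> where "\<kappa> = sqrt (real F * real G) / 2 ^ card I"
    have \<kappa>: "0 < \<kappa>" using Fpos Gpos by (simp add: \<kappa>_def)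
    have "(2 ^ card I)\<^sup>2 = (4::real) ^ card I"
      by (simp add: power2_eq_square flip: power_mult_distrib)
    then have \<kappa>2: "\<kappa>\<^sup>2 = real F * real G / 4 ^ card I"
      by (simp add: \<kappa>_def power_divide)
    define h where "h u = \<kappa> * real (card (slice i C u))" for u
    have "real (sum (\<lambda>x. G * f x) X + sum (\<lambda>y. F * g y) Y) \<le> sum h ((\<lambda>x. x i) ` C)"
    proof (rule sum_add_sum_le_sum_of_min_le[where m = "F * G"])
      fix x y e :: int assume xy: "x \<in> X" "y \<in> Y" "e \<in> {0, 1}"
      have "(min (G * f x) (F * g y))\<^sup>2 \<le> (G * f x) * (F * g y)"
        unfolding power2_eq_square by (intro mult_le_mono) auto
      then have "real ((min (G * f x) (F * g y))\<^sup>2) \<le> real ((G * f x) * (F * g y))"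
        by (simp only: of_nat_le_iff)
      also have "\<dots> = real F * real G * (real (4 ^ card I * f x * g y) / 4 ^ card I)" by simp
      also have "\<dots> \<le> real F * real G * (real (card (slice i C (x + y + e)) ^ 2) / 4 ^ card I)"
        using slices[OF xy(3), of x y] by (intro mult_left_mono divide_right_mono) (auto simp only: of_nat_le_iff, auto)
      also have "\<dots> = (h (x + y + e))\<^sup>2"
        by (simp add: h_def power_mult_distrib \<kappa>2)
      finally show "real (min (G * f x) (F * g y)) \<le> h (x + y + e)"
        unfolding of_nat_power by (rule power2_le_imp_le) (use \<kappa> in \<open>simp add: h_def\<close>)
    next
      fix u assume "0 < h u"
      then have "slice i C u \<noteq> {}" by (auto simp: h_def)
      then show "u \<in> (\<lambda>x. x i) ` C" by (auto simp: slice_def)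
    qed (use fin F G exF exG \<kappa> in \<open>auto simp: h_def mult.commute\<close>)
    also have "sum h ((\<lambda>x. x i) ` C) = \<kappa> * real (card C)"
      unfolding h_def card_eq_sum_slice[OF fin(1), of i] by (simp add: sum_distrib_left)
    also have "sum (\<lambda>x. G * f x) X + sum (\<lambda>y. F * g y) Y = G * card A + F * card B"
      unfolding card_eq_sum_slice[OF insert.prems(1), of i] card_eq_sum_slice[OF insert.prems(2), of i]
      by (simp add: sum_distrib_left f_def g_def X_def Y_def)
    finally have le: "real (G * card A + F * card B) \<le> \<kappa> * real (card C)" .
    \<comment> \<open>The inequality of means returns to the product form; \<open>F * G\<close>
      appears on both sides and cancels.\<close>
    have "4 * (real (G * card A) * real (F * card B)) \<le> (real (G * card A + F * card B))\<^sup>2"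
      using sum_squares_ge_zero[of "real (G * card A) - real (F * card B)" 0]
      by (simp add: power2_eq_square algebra_simps)
    also have "\<dots> \<le> (\<kappa> * real (card C))\<^sup>2"
      using le by (intro power_mono) auto
    also have "\<dots> = real F * real G / 4 ^ card I * real (card C) ^ 2"
      by (simp add: power_mult_distrib \<kappa>2)
    finally have "real F * real G * (4 * (real (card A) * real (card B)))
        \<le> real F * real G * (real (card C) ^ 2 / 4 ^ card I)"
      by (simp add: mult_ac)
    then have "4 * (real (card A) * real (card B)) \<le> real (card C) ^ 2 / 4 ^ card I"
      using Fpos Gpos by (subst (asm) mult_le_cancel_left_pos) auto
    then have "real (4 ^ card (insert i I) * card A * card B) \<le> real (card C ^ 2)"
      using insert.hyps by (simp add: field_simps)
    then show ?thesis unfolding C_def by (simp only: of_nat_le_iff)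
  qed auto
qed

section \<open>Lattice points in balls: isodiametric bound and comparison with volume\<close>

definition lattice_point :: "('n::finite \<Rightarrow> int) \<Rightarrow> real ^ 'n" where
  "lattice_point z = (\<chi> i. real_of_int (z i))"

definition lattice_ball :: "real \<Rightarrow> ('n::finite \<Rightarrow> int) set" where
  "lattice_ball R = {z. norm (lattice_point z) \<le> R}"

lemma lattice_point_nth [simp]: "lattice_point z $ i = real_of_int (z i)"
  by (simp add: lattice_point_def)

lemma finite_lattice_ball: "finite (lattice_ball R :: ('n::finite \<Rightarrow> int) set)"
proof -
  have "lattice_ball R \<subseteq> (UNIV :: 'n set) \<rightarrow>\<^sub>E {-\<lceil>R\<rceil>..\<lceil>R\<rceil>}"
  proof
    fix z :: "'n \<Rightarrow> int" assume z: "z \<in> lattice_ball R"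
    have "-\<lceil>R\<rceil> \<le> z i \<and> z i \<le> \<lceil>R\<rceil>" for i
    proof -
      from z have "\<bar>real_of_int (z i)\<bar> \<le> R"
      using component_le_norm_cart[of "lattice_point z" i] by (simp add: lattice_ball_def)
      then show ?thesis by linarith
    qed
    then show "z \<in> (UNIV :: 'n set) \<rightarrow>\<^sub>E {-\<lceil>R\<rceil>..\<lceil>R\<rceil>}" by auto
  qed
  then show ?thesis by (rule finite_subset) (auto intro!: finite_PiE)
qed

text \<open>A bound through the l1 norm; errors of order \<open>d\<close> disappear for large
  radii.\<close>

lemma norm_le_CARD:
  fixes x :: "real ^ 'n::finite"
  assumes "\<And>i. \<bar>x $ i\<bar> \<le> 1"
  shows "norm x \<le> real CARD('n)"
proof -
  have "norm x \<le> (\<Sum>i\<in>UNIV. \<bar>x $ i\<bar>)" by (rule norm_le_l1_cart)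
  also have "\<dots> \<le> (\<Sum>i\<in>(UNIV :: 'n set). 1)" using assms by (intro sum_mono)
  finally show ?thesis by simp
qed

text \<open>Brunn-Minkowski for \<open>S\<close> and \<open>- S\<close>: all differences have norm
  at most the diameter, and the cube vector adds at most \<open>d\<close>. As \<open>- S\<close> has
  as many points as \<open>S\<close>, the multiplicative form loses nothing. The factor
  \<open>2 ^ d\<close> is what reduces the radius from the diameter to half of it.\<close>

lemma card_le_card_lattice_ball:
  fixes S :: "('n::finite \<Rightarrow> int) set"
  assumes "finite S"
  shows "2 ^ CARD('n) * card S
    \<le> card (lattice_ball (diameter (lattice_point ` S) + real CARD('n)) :: ('n \<Rightarrow> int) set)"
proof -
  define T where "T = (\<lambda>z i. - z i) ` S"
  have cT: "card T = card S" "finite T"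
    unfolding T_def using assms by (auto intro!: card_image simp: inj_on_def fun_eq_iff)
  have bS: "bounded (lattice_point ` S)" using assms by (intro finite_imp_bounded) auto
  have "cube_sum UNIV S T \<subseteq> lattice_ball (diameter (lattice_point ` S) + real CARD('n))"
  proof
    fix w assume "w \<in> cube_sum UNIV S T"
    then obtain a b e where w: "a \<in> S" "b \<in> S" "e \<in> cube UNIV" "w = (\<lambda>i. a i + - b i + e i)"
      by (auto simp: cube_sum_def T_def)
    have "lattice_point w = (lattice_point a - lattice_point b) + lattice_point e"
      by (simp add: vec_eq_iff w(4))
    then have "norm (lattice_point w) \<le> norm (lattice_point a - lattice_point b) + norm (lattice_point e)"
      by (simp add: norm_triangle_ineq)
    also have "norm (lattice_point a - lattice_point b) \<le> diameter (lattice_point ` S)"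
      using w bS diameter_bounded_bound[of "lattice_point ` S" "lattice_point a" "lattice_point b"]
      by (simp add: dist_norm)
    also have "norm (lattice_point e) \<le> real CARD('n)"
    proof (rule norm_le_CARD)
      fix i
      have "e i \<in> {0, 1}" using w(3) by (auto simp: cube_def)
      then show "\<bar>lattice_point e $ i\<bar> \<le> 1" by auto
    qed
    finally show "w \<in> lattice_ball (diameter (lattice_point ` S) + real CARD('n))"
      by (simp add: lattice_ball_def)
  qed
  then have "card (cube_sum UNIV S T) \<le> card (lattice_ball (diameter (lattice_point ` S) + real CARD('n)) :: ('n \<Rightarrow> int) set)"
    by (intro card_mono finite_lattice_ball)
  moreover have "(2 ^ CARD('n) * card S)\<^sup>2 \<le> card (cube_sum UNIV S T) ^ 2"
    using card_cube_sum[of S T UNIV] assms cT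
    by (simp add: power2_eq_square power_mult_distrib[symmetric] mult_ac)
  then have "2 ^ CARD('n) * card S \<le> card (cube_sum UNIV S T)"
    by (rule power2_le_imp_le) simp
  ultimately show ?thesis by linarith
qed

lemma dist_lattice_point_ge_1:
  assumes "z \<noteq> z'"
  shows "1 \<le> dist (lattice_point z) (lattice_point z')"
proof -
  obtain i where "z i \<noteq> z' i" using assms by auto
  then have "1 \<le> \<bar>(lattice_point z - lattice_point z') $ i\<bar>" by simp
  also have "\<dots> \<le> norm (lattice_point z - lattice_point z')" by (rule component_le_norm_cart)
  finally show ?thesis by (simp add: dist_norm)
qed

lemma content_unit_cube:
  fixes a :: "real ^ 'n::finite"
  shows "measure lborel (cbox a (a + 1)) = 1" "measure lborel (box a (a + 1)) = 1"
proof -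
  show "measure lborel (cbox a (a + 1)) = 1"
    by (subst content_cbox_cart) (auto simp: interval_ne_empty_cart)
  then show "measure lborel (box a (a + 1)) = 1" by (simp add: measure_lborel_box_eq measure_lborel_cbox_eq)
qed

text \<open>Open unit cubes at the lattice points are disjoint and lie in the enlarged ball.\<close>

lemma card_lattice_ball_upper:
  assumes "0 \<le> R"
  shows "real (card (lattice_ball R :: ('n::finite \<Rightarrow> int) set))
    \<le> unit_ball_vol (real CARD('n)) * (R + real CARD('n)) ^ CARD('n)"
proof -
  define S where "S = (lattice_ball R :: ('n \<Rightarrow> int) set)"
  have "finite S" by (simp add: S_def finite_lattice_ball)
  define Q where "Q z = box (lattice_point z) (lattice_point z + 1)" for z :: "'n \<Rightarrow> int"
  have disj: "Q z \<inter> Q z' = {}" if "z \<noteq> z'" for z z'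
  proof (rule ccontr)
    assume "Q z \<inter> Q z' \<noteq> {}"
    then obtain x where x: "x \<in> Q z" "x \<in> Q z'" by auto
    have "z i = z' i" for i
    proof -
      have "real_of_int (z i) < x $ i" "x $ i < real_of_int (z i) + 1"
        "real_of_int (z' i) < x $ i" "x $ i < real_of_int (z' i) + 1"
        using x by (auto simp: Q_def mem_box_cart)
      then show ?thesis by linarith
    qed
    then show False using that by auto
  qed
  have "real (card S) = (\<Sum>z\<in>S. measure lborel (Q z))"
    by (simp add: Q_def content_unit_cube)
  also have "\<dots> = measure lebesgue (\<Union>z\<in>S. Q z)"
    using \<open>finite S\<close> disj
    by (subst measure_UNION'[of S Q]) (auto simp: Q_def pairwise_def disjnt_def measure_completion)
  also have "\<dots> \<le> measure lebesgue (cball 0 (R + real CARD('n)) :: (real ^ 'n) set)"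
  proof (rule measure_mono_fmeasurable)
    show "(\<Union>z\<in>S. Q z) \<subseteq> cball 0 (R + real CARD('n))"
    proof clarsimp
      fix z x assume z: "z \<in> S" "x \<in> Q z"
      have "\<bar>(x - lattice_point z) $ i\<bar> \<le> 1" for i
        using z(2) by (auto simp: Q_def mem_box_cart abs_le_iff dest!: spec[of _ i])
      then have "norm (x - lattice_point z) \<le> real CARD('n)" by (rule norm_le_CARD)
      then show "norm x \<le> R + real CARD('n)"
        using z(1) norm_triangle_ineq[of "lattice_point z" "x - lattice_point z"]
        by (simp add: S_def lattice_ball_def)
    qed
  qed (use \<open>finite S\<close> in \<open>auto simp: Q_def\<close>)
  also have "\<dots> = unit_ball_vol (real CARD('n)) * (R + real CARD('n)) ^ CARD('n)"
    using content_cball[of "R + real CARD('n)" "0 :: real ^ 'n"] assms by (simp add: measure_completion)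
  finally show ?thesis by (simp add: S_def)
qed

text \<open>Rounding all coordinates down shows that the closed unit cubes at the lattice points
  cover the shrunk ball.\<close>

lemma card_lattice_ball_lower:
  assumes "real CARD('n) \<le> R"
  shows "unit_ball_vol (real CARD('n)) * (R - real CARD('n)) ^ CARD('n)
    \<le> real (card (lattice_ball R :: ('n::finite \<Rightarrow> int) set))"
proof -
  define S where "S = (lattice_ball R :: ('n \<Rightarrow> int) set)"
  have "finite S" by (simp add: S_def finite_lattice_ball)
  define Q where "Q z = cbox (lattice_point z) (lattice_point z + 1)" for z :: "'n \<Rightarrow> int"
  have "unit_ball_vol (real CARD('n)) * (R - real CARD('n)) ^ CARD('n)
      = measure lebesgue (cball 0 (R - real CARD('n)) :: (real ^ 'n) set)"
    using content_cball[of "R - real CARD('n)" "0 :: real ^ 'n"] assms by (simp add: measure_completion)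
  also have "\<dots> \<le> measure lebesgue (\<Union>z\<in>S. Q z)"
  proof (rule measure_mono_fmeasurable)
    show "cball 0 (R - real CARD('n)) \<subseteq> (\<Union>z\<in>S. Q z)"
    proof
      fix x :: "real ^ 'n" assume x: "x \<in> cball 0 (R - real CARD('n))"
      define z where "z i = \<lfloor>x $ i\<rfloor>" for i
      have "\<bar>(lattice_point z - x) $ i\<bar> \<le> 1" for i
        unfolding z_def by (simp add: abs_le_iff) linarith
      then have "norm (lattice_point z - x) \<le> real CARD('n)" by (rule norm_le_CARD)
      then have "z \<in> S"
        using x norm_triangle_ineq[of x "lattice_point z - x"] by (simp add: S_def lattice_ball_def)
      moreover have "x \<in> Q z"
        unfolding Q_def mem_box_cart by (simp add: z_def)
      ultimately show "x \<in> (\<Union>z\<in>S. Q z)" by auto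
    qed
    show "(\<Union>z\<in>S. Q z) \<in> lmeasurable"
      using \<open>finite S\<close> by (intro fmeasurable.finite_UN) (auto simp: Q_def)
  qed auto
  also have "\<dots> \<le> (\<Sum>z\<in>S. measure lebesgue (Q z))"
    using \<open>finite S\<close> by (intro measure_UNION_le) (auto simp: Q_def)
  also have "\<dots> = real (card S)" by (simp add: Q_def content_unit_cube measure_completion)
  finally show ?thesis by (simp add: S_def)
qed

subsection \<open>Choice of the parameters\<close>

text \<open>The difference of the squares is
  \<open>(t - 1) * ((t + 1) * (a \<bullet> a) - 2 * (a \<bullet> b))\<close>, and
  \<open>a \<bullet> b \<le> a \<bullet> a\<close>. This keeps the digits separated while the
  extreme one moves outwards.\<close>

lemma norm_scaleR_diff_ge:
  fixes a b :: "'a::real_inner"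
  assumes "1 \<le> t" "norm b \<le> norm a"
  shows "norm (a - b) \<le> norm (t *\<^sub>R a - b)"
proof -
  have "a \<bullet> b \<le> norm a * norm b" by (rule norm_cauchy_schwarz)
  also have "\<dots> \<le> norm a * norm a" using assms by (intro mult_left_mono) auto
  finally have ab: "a \<bullet> b \<le> a \<bullet> a" by (simp add: norm_eq_sqrt_inner)
  have "0 \<le> (t - 1) * ((t + 1) * (a \<bullet> a) - 2 * (a \<bullet> b))"
  proof (intro mult_nonneg_nonneg)
    have "2 * (a \<bullet> a) \<le> (t + 1) * (a \<bullet> a)" using assms by (intro mult_right_mono) auto
    then show "0 \<le> (t + 1) * (a \<bullet> a) - 2 * (a \<bullet> b)" using ab by linarith
  qed (use assms in auto)
  then show ?thesis
    unfolding norm_le by (simp add: inner_diff_left inner_diff_right inner_commute algebra_simps)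
qed

text \<open>Here \<open>x\<close> is the diameter of a set of digits,
  \<open>2 * \<rho> / (1 - r)\<close> bounds \<open>|K|\<close>, \<open>4 * (\<rho> * r)\<close>
  bounds the loss \<open>r |K|\<close>, and the powers of \<open>x + 2 * d\<close> and
  \<open>\<rho> - d\<close> are lattice point counts without the volume of the unit ball. For
  \<open>x \<ge> x0\<close> the quotient of \<open>x + 2 * d\<close> and \<open>x\<close> is at most
  \<open>1 + 2 * d / x0\<close>, and \<open>x powr (d - s) \<le> (2 * \<rho>) powr (d - s)\<close>.
  For \<open>x < x0\<close> the left side has only the order of \<open>\<rho> powr s\<close>,
  against \<open>\<rho> ^ d\<close> on the right.\<close>

lemma scale_estimate:
  fixes s c r \<rho> x x0 :: real and d :: nat
  assumes s: "0 < s" and c: "0 < c" and r: "0 < r" "r < 1 / 2"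
    and \<rho>: "real d < \<rho>" "4 * (\<rho> * r) \<le> 1 / 2" and x: "1 \<le> x" "x \<le> 2 * \<rho>" and x0: "1 \<le> x0"
    and sd: "s < real d"
    and large: "c * (1 / (1 - r)) powr s * (1 + 2 * real d / x0) ^ d * (1 / (1 - 4 * (\<rho> * r))) powr s
      \<le> (1 - real d / \<rho>) ^ d"
    and small: "c * (1 / (1 - r)) powr s * 2 powr s * 2 powr (s - real d) * (x0 + 2 * real d) ^ d
      * \<rho> powr (s - real d) \<le> (1 - real d / \<rho>) ^ d"
  shows "c * (2 * \<rho> / (1 - r)) powr s * (x + 2 * real d) ^ d
    \<le> 2 ^ d * (\<rho> - real d) ^ d * (x - 4 * (\<rho> * r)) powr s"
proof -
  define A where "A = c * (1 / (1 - r)) powr s"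
  define \<epsilon> where "\<epsilon> = 4 * (\<rho> * r)"
  define q where "q = (1 - real d / \<rho>) ^ d"
  have A: "0 < A" using c r by (simp add: A_def)
  have "0 < \<rho>" using \<rho>(1) by (rule le_less_trans[OF of_nat_0_le_iff])
  then have \<epsilon>: "0 < \<epsilon>" "\<epsilon> \<le> 1 / 2" using r \<rho> by (auto simp: \<epsilon>_def)
  have q: "(\<rho> - real d) ^ d = \<rho> ^ d * q"
    unfolding q_def using \<open>0 < \<rho>\<close> by (simp add: field_simps flip: power_mult_distrib)
  have "(2 * \<rho> / (1 - r)) powr s = (2 * \<rho>) powr s * (1 / (1 - r)) powr s"
    using \<open>0 < \<rho>\<close> r by (simp flip: powr_mult)
  then have lhs: "c * (2 * \<rho> / (1 - r)) powr s * (x + 2 * real d) ^ d = A * (2 * \<rho>) powr s * (x + 2 * real d) ^ d"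
    by (simp add: A_def mult_ac)
  have split: "y powr s * y powr (real d - s) = y ^ d" if "0 < y" for y :: real
    using that by (simp add: powr_realpow flip: powr_add)
  show ?thesis
  proof (cases "x0 \<le> x")
    case True
    have "x + 2 * real d \<le> (1 + 2 * real d / x0) * x"
    proof -
      have "2 * real d * 1 \<le> 2 * real d * (x / x0)" using True x0 by (intro mult_left_mono) auto
      then show ?thesis by (simp add: algebra_simps)
    qed
    then have "(x + 2 * real d) ^ d \<le> ((1 + 2 * real d / x0) * x) ^ d"
      using x by (intro power_mono) auto
    also have "\<dots> = (1 + 2 * real d / x0) ^ d * (x powr s * x powr (real d - s))"
      using x by (simp add: power_mult_distrib split)
    also have "\<dots> \<le> (1 + 2 * real d / x0) ^ d * (((1 / (1 - \<epsilon>)) powr s * (x - \<epsilon>) powr s) * (2 * \<rho>) powr (real d - s))"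
    proof (intro mult_left_mono mult_mono)
      have "x \<le> 1 / (1 - \<epsilon>) * (x - \<epsilon>)"
        using \<epsilon> x mult_left_mono[of 1 x \<epsilon>] by (simp add: field_simps)
      then have "x powr s \<le> (1 / (1 - \<epsilon>) * (x - \<epsilon>)) powr s"
        using s x by (intro powr_mono2) auto
      also have "\<dots> = (1 / (1 - \<epsilon>)) powr s * (x - \<epsilon>) powr s"
        by (rule powr_mult)
      finally show "x powr s \<le> (1 / (1 - \<epsilon>)) powr s * (x - \<epsilon>) powr s" .
      show "x powr (real d - s) \<le> (2 * \<rho>) powr (real d - s)"
        using x sd by (intro powr_mono2) auto
    qed (use x0 in auto)
    finally have "A * (2 * \<rho>) powr s * (x + 2 * real d) ^ d
      \<le> A * (2 * \<rho>) powr s * ((1 + 2 * real d / x0) ^ d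
        * (((1 / (1 - \<epsilon>)) powr s * (x - \<epsilon>) powr s) * (2 * \<rho>) powr (real d - s)))"
      using A by (intro mult_left_mono) auto
    also have "\<dots> = (A * (1 + 2 * real d / x0) ^ d * (1 / (1 - \<epsilon>)) powr s)
        * ((2 * \<rho>) powr s * (2 * \<rho>) powr (real d - s)) * (x - \<epsilon>) powr s"
      by (simp only: mult_ac)
    also have "\<dots> \<le> q * ((2 * \<rho>) powr s * (2 * \<rho>) powr (real d - s)) * (x - \<epsilon>) powr s"
      using large unfolding A_def \<epsilon>_def q_def by (intro mult_right_mono) auto
    also have "\<dots> = 2 ^ d * (\<rho> ^ d * q) * (x - \<epsilon>) powr s"
      using \<open>0 < \<rho>\<close> by (simp only: split mult_pos_pos zero_less_numeral power_mult_distrib mult_ac)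
    finally show ?thesis unfolding lhs q \<epsilon>_def .
  next
    case False
    have "(x + 2 * real d) ^ d \<le> (x0 + 2 * real d) ^ d"
      using x False by (intro power_mono) auto
    then have "A * (2 * \<rho>) powr s * (x + 2 * real d) ^ d \<le> A * (2 * \<rho>) powr s * (x0 + 2 * real d) ^ d"
      using A by (intro mult_left_mono) auto
    also have "A * (2 * \<rho>) powr s * (x0 + 2 * real d) ^ d
      = A * (2 powr (s - real d) * \<rho> powr (s - real d) * (2 ^ d * \<rho> ^ d)) * (x0 + 2 * real d) ^ d"
      using \<open>0 < \<rho>\<close> by (simp add: powr_mult powr_diff powr_realpow)
    also have "\<dots> = (A * 2 powr s * 2 powr (s - real d) * (x0 + 2 * real d) ^ d * \<rho> powr (s - real d)) * (2 ^ d * \<rho> ^ d) * (1 / 2) powr s"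
      by (simp add: powr_divide)
    also have "\<dots> \<le> q * (2 ^ d * \<rho> ^ d) * (1 / 2) powr s"
      using small \<open>0 < \<rho>\<close> unfolding A_def q_def by (intro mult_right_mono) auto
    \<comment> \<open>From \<open>1 \<le> x\<close> and \<open>\<epsilon> \<le> 1 / 2\<close>
      follows \<open>x - \<epsilon> \<ge> 1 / 2\<close>, the origin of the factor
      \<open>2 powr s\<close> in \<open>small\<close>.\<close>
    also have "\<dots> \<le> q * (2 ^ d * \<rho> ^ d) * (x - \<epsilon>) powr s"
      using s x \<epsilon> \<rho>(1) \<open>0 < \<rho>\<close> by (intro mult_left_mono powr_mono2) (auto simp: q_def)
    finally show ?thesis unfolding lhs q \<epsilon>_def by (simp only: mult_ac)
  qed
qed

text \<open>The solution \<open>r\<close> of \<open>N * r powr s = 1\<close> for the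
  \<open>N\<close> lattice points in the ball of radius \<open>n\<close>; the \<open>itself\<close>
  argument carries the dimension.\<close>

definition ratio :: "real \<Rightarrow> 'n::finite itself \<Rightarrow> nat \<Rightarrow> real" where
  "ratio s _ n = real (card (lattice_ball (real n) :: ('n \<Rightarrow> int) set)) powr (- 1 / s)"

text \<open>\<open>N\<close> is at least of order \<open>n ^ d\<close>, so \<open>r\<close> is at
  most of order \<open>n powr (- d / s)\<close>; as \<open>d / s > 1\<close>, even
  \<open>n * r\<close> tends to 0. This compares the size of the pieces with the unit distance of
  the digits.\<close>

lemma ratio_tendsto_0:
  assumes "0 < s" "s < real CARD('n::finite)"
  shows "(\<lambda>n. real n * ratio s TYPE('n) n) \<longlonglongrightarrow> 0" "ratio s TYPE('n) \<longlonglongrightarrow> 0"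
proof -
  define d where "d = CARD('n)"
  define a where "a = unit_ball_vol (real d) / 2 ^ d"
  have a: "0 < a" by (simp add: a_def)
  \<comment> \<open>\<open>2 * d \<le> n\<close> gives \<open>n - d \<ge> n / 2\<close>, whence the
    power of 2 in \<open>a\<close>.\<close>
  have bound: "ratio s TYPE('n) n \<le> a powr (- 1 / s) * real n powr (- real d / s)"
    if n: "2 * d \<le> n" "1 \<le> n" for n
  proof -
    have "a * real n ^ d = unit_ball_vol (real d) * (real n / 2) ^ d"
      by (simp add: a_def power_divide)
    also have "\<dots> \<le> unit_ball_vol (real d) * (real n - real d) ^ d"
      using n by (intro mult_left_mono power_mono) auto
    also have "\<dots> \<le> real (card (lattice_ball (real n) :: ('n \<Rightarrow> int) set))"
      using n unfolding d_def by (intro card_lattice_ball_lower) auto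
    finally have "ratio s TYPE('n) n \<le> (a * real n ^ d) powr (- 1 / s)"
      unfolding ratio_def using assms a n by (intro powr_mono2') auto
    also have "\<dots> = a powr (- 1 / s) * real n powr (- real d / s)"
      using a n by (simp add: powr_mult powr_powr flip: powr_realpow)
    finally show ?thesis .
  qed
  have nonneg: "0 \<le> ratio s TYPE('n) n" for n by (simp add: ratio_def)
  have "(\<lambda>n. a powr (- 1 / s) * real n powr (1 - real d / s)) \<longlonglongrightarrow> a powr (- 1 / s) * 0"
    using assms by (intro tendsto_mult tendsto_const tendsto_neg_powr filterlim_real_sequentially)
      (simp add: d_def)
  then have lim: "(\<lambda>n. a powr (- 1 / s) * real n powr (1 - real d / s)) \<longlonglongrightarrow> 0" by simp
  have ev: "\<forall>\<^sub>F n in sequentially. 2 * d \<le> n \<and> 1 \<le> n"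
    by (intro eventually_conj eventually_ge_at_top)
  show 1: "(\<lambda>n. real n * ratio s TYPE('n) n) \<longlonglongrightarrow> 0"
  proof (rule Lim_null_comparison[OF _ lim], rule eventually_mono[OF ev])
    fix n assume n: "2 * d \<le> n \<and> 1 \<le> n"
    have "real n * ratio s TYPE('n) n \<le> real n * (a powr (- 1 / s) * real n powr (- real d / s))"
      using bound n by (intro mult_left_mono) auto
    also have "\<dots> = a powr (- 1 / s) * (real n powr 1 * real n powr (- real d / s))" using n by simp
    also have "\<dots> = a powr (- 1 / s) * real n powr (1 - real d / s)"
      unfolding powr_add[symmetric] by simp
    finally show "norm (real n * ratio s TYPE('n) n) \<le> a powr (- 1 / s) * real n powr (1 - real d / s)"
      using nonneg by simp
  qed
  show "ratio s TYPE('n) \<longlonglongrightarrow> 0"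
  proof (rule Lim_null_comparison[OF _ 1], rule eventually_mono[OF ev])
    fix n assume "2 * d \<le> n \<and> 1 \<le> n"
    then show "norm (ratio s TYPE('n) n) \<le> real n * ratio s TYPE('n) n"
      using nonneg mult_right_mono[of 1 "real n" "ratio s TYPE('n) n"] by simp
  qed
qed

text \<open>The order of choice matters: \<open>x0\<close> comes first, from
  \<open>c * (1 + 2 * d / x0) ^ d < 1\<close>, where \<open>c < 1\<close> enters. With
  \<open>x0\<close> fixed, everything holds for large \<open>n\<close>, since \<open>r\<close>,
  \<open>n * r\<close> and \<open>n powr (s - d)\<close> tend to 0. The condition with 24 serves the
  far end of the path, the last two are those of \<open>scale_estimate\<close>.\<close>

lemma ex_scale:
  assumes s: "0 < s" "s < real CARD('n::finite)" and c: "0 < c" "c < 1"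
  obtains n x0 where "CARD('n) < n" "1 \<le> x0" "ratio s TYPE('n) n < 1 / 2" "real n * ratio s TYPE('n) n < 1 / 8"
    "(24 * (real n * ratio s TYPE('n) n)) powr s + ratio s TYPE('n) n powr s < c"
    "c * (1 / (1 - ratio s TYPE('n) n)) powr s * (1 + 2 * real CARD('n) / x0) ^ CARD('n)
        * (1 / (1 - 4 * (real n * ratio s TYPE('n) n))) powr s < (1 - real CARD('n) / real n) ^ CARD('n)"
    "c * (1 / (1 - ratio s TYPE('n) n)) powr s * 2 powr s * 2 powr (s - real CARD('n))
        * (x0 + 2 * real CARD('n)) ^ CARD('n) * real n powr (s - real CARD('n))
      < (1 - real CARD('n) / real n) ^ CARD('n)"
proof -
  define d where "d = CARD('n)"
  define r where "r = ratio s TYPE('n)"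
  have r0: "r \<longlonglongrightarrow> 0" and e0: "(\<lambda>n. real n * r n) \<longlonglongrightarrow> 0"
    using ratio_tendsto_0[OF s] by (auto simp: r_def)
  have rnn: "0 \<le> r n" for n by (simp add: r_def ratio_def)
  have inv: "((\<lambda>x::real. 1 / x) \<longlongrightarrow> 0) at_top"
    using tendsto_inverse_0_at_top[OF filterlim_ident] by (simp add: inverse_eq_divide)
  have "((\<lambda>x. c * (1 + 2 * real d * (1 / x)) ^ d) \<longlongrightarrow> c * (1 + 2 * real d * 0) ^ d) at_top"
    by (intro tendsto_intros inv)
  then have "\<forall>\<^sub>F x in at_top. c * (1 + 2 * real d * (1 / x)) ^ d < 1"
    using c by (intro order_tendstoD(2)[where y = "c * (1 + 2 * real d * 0) ^ d"]) auto
  then have "\<forall>\<^sub>F x in at_top. 1 \<le> x \<and> c * (1 + 2 * real d * (1 / x)) ^ d < 1"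
    by (intro eventually_conj eventually_ge_at_top)
  then obtain x0 where x0: "1 \<le> x0" "c * (1 + 2 * real d / x0) ^ d < 1"
    by (auto dest!: eventually_happens)
  have q: "(\<lambda>n. (1 - real d / real n) ^ d) \<longlonglongrightarrow> (1 - 0) ^ d"
    by (intro tendsto_intros tendsto_divide_0[OF tendsto_const] filterlim_at_top_imp_at_infinity filterlim_real_sequentially)
  have 1: "\<forall>\<^sub>F n in sequentially. d < n" by (rule eventually_gt_at_top)
  have 2: "\<forall>\<^sub>F n in sequentially. r n < 1 / 2" by (rule order_tendstoD(2)[OF r0]) simp
  have 3: "\<forall>\<^sub>F n in sequentially. real n * r n < 1 / 8" by (rule order_tendstoD(2)[OF e0]) simp
  have "(\<lambda>n. (24 * (real n * r n)) powr s + r n powr s) \<longlonglongrightarrow> 0 + 0"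
    using s rnn tendsto_mult_right[OF e0, of 24] r0
    by (intro tendsto_add tendsto_zero_powrI[where b = s] tendsto_const) auto
  then have 4: "\<forall>\<^sub>F n in sequentially. (24 * (real n * r n)) powr s + r n powr s < c"
    using c by (intro order_tendstoD(2)[where y = "0 + 0"]) auto
  have "(\<lambda>n. c * (1 / (1 - r n)) powr s * (1 + 2 * real d / x0) ^ d * (1 / (1 - 4 * (real n * r n))) powr s
      - (1 - real d / real n) ^ d)
    \<longlonglongrightarrow> c * (1 / (1 - 0)) powr s * (1 + 2 * real d / x0) ^ d * (1 / (1 - 4 * 0)) powr s - (1 - 0) ^ d"
    by (intro tendsto_intros r0 e0 q) auto
  then have 5: "\<forall>\<^sub>F n in sequentially. c * (1 / (1 - r n)) powr s * (1 + 2 * real d / x0) ^ d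
      * (1 / (1 - 4 * (real n * r n))) powr s - (1 - real d / real n) ^ d < 0"
    using x0 by (elim order_tendstoD(2)) auto
  have "(\<lambda>n. c * (1 / (1 - r n)) powr s * 2 powr s * 2 powr (s - real d) * (x0 + 2 * real d) ^ d
        * real n powr (s - real d) - (1 - real d / real n) ^ d)
    \<longlonglongrightarrow> c * (1 / (1 - 0)) powr s * 2 powr s * 2 powr (s - real d) * (x0 + 2 * real d) ^ d * 0 - (1 - 0) ^ d"
    using s by (intro tendsto_intros r0 q tendsto_neg_powr filterlim_real_sequentially) (auto simp: d_def)
  then have 6: "\<forall>\<^sub>F n in sequentially. c * (1 / (1 - r n)) powr s * 2 powr s * 2 powr (s - real d)
      * (x0 + 2 * real d) ^ d * real n powr (s - real d) - (1 - real d / real n) ^ d < 0"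
    by (elim order_tendstoD(2)) auto
  from eventually_happens[OF eventually_conj[OF 1 eventually_conj[OF 2 eventually_conj[OF 3
    eventually_conj[OF 4 eventually_conj[OF 5 6]]]]]]
  obtain n where "d < n" "r n < 1 / 2" "real n * r n < 1 / 8"
    "(24 * (real n * r n)) powr s + r n powr s < c"
    "c * (1 / (1 - r n)) powr s * (1 + 2 * real d / x0) ^ d
      * (1 / (1 - 4 * (real n * r n))) powr s - (1 - real d / real n) ^ d < 0"
    "c * (1 / (1 - r n)) powr s * 2 powr s * 2 powr (s - real d)
      * (x0 + 2 * real d) ^ d * real n powr (s - real d) - (1 - real d / real n) ^ d < 0"
    by auto
  then show ?thesis
    using x0(1) unfolding d_def r_def by (intro that[of n x0]) auto
qed

section \<open>The one-parameter family and the conclusion\<close>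

theorem theorem1p2:
  fixes s c :: real
  assumes "0 < s" and "s < real CARD('n::finite)"
    and "0 < c" and "c < 1"
  shows "\<exists>K :: (real ^ 'n) set.
    (\<exists>l \<phi>. similitude_ifs l \<phi> \<and> is_attractor l \<phi> K \<and> strong_separation l \<phi> K) \<and>
    hausdorff_dim K = ereal s \<and>
    hausdorff_measure s K = ennreal (c * diameter K powr s)"
proof -
  define d where "d = real CARD('n)"
  obtain n x0 where n: "CARD('n) < n" and x0: "1 \<le> x0"
    and r12: "ratio s TYPE('n) n < 1 / 2" and e: "real n * ratio s TYPE('n) n < 1 / 8"
    and far: "(24 * (real n * ratio s TYPE('n) n)) powr s + ratio s TYPE('n) n powr s < c"
    and large: "c * (1 / (1 - ratio s TYPE('n) n)) powr s * (1 + 2 * real CARD('n) / x0) ^ CARD('n)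
        * (1 / (1 - 4 * (real n * ratio s TYPE('n) n))) powr s < (1 - real CARD('n) / real n) ^ CARD('n)"
    and small: "c * (1 / (1 - ratio s TYPE('n) n)) powr s * 2 powr s * 2 powr (s - real CARD('n))
        * (x0 + 2 * real CARD('n)) ^ CARD('n) * real n powr (s - real CARD('n))
      < (1 - real CARD('n) / real n) ^ CARD('n)"
    using ex_scale[OF assms] by metis
  define \<rho> where "\<rho> = real n"
  define Z where "Z = (lattice_ball \<rho> :: ('n \<Rightarrow> int) set)"
  define r where "r = ratio s TYPE('n) n"
  define i0 :: 'n where "i0 = undefined"
  \<comment> \<open>The integer radius puts this lattice point exactly on the sphere, so it is a
    digit of maximal norm. Its antipode \<open>z1\<close> serves to bound diameters from
    below.\<close>
  define z0 :: "'n \<Rightarrow> int" where "z0 = (\<lambda>i. if i = i0 then int n else 0)"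
  define z1 :: "'n \<Rightarrow> int" where "z1 = (\<lambda>i. - z0 i)"
  have "0 < n" using n by simp
  have \<rho>: "d < \<rho>" "1 \<le> \<rho>" using n by (auto simp: \<rho>_def d_def)
  have z0: "norm (lattice_point z0) = \<rho>"
  proof -
    have "lattice_point z0 = \<rho> *\<^sub>R axis i0 1"
      by (auto simp: vec_eq_iff z0_def axis_def \<rho>_def)
    then show ?thesis by (simp add: \<rho>_def)
  qed
  have z1: "lattice_point z1 = - lattice_point z0"
    by (simp add: vec_eq_iff z1_def)
  have z01: "z0 \<in> Z" "z1 \<in> Z" "z0 \<noteq> z1"
    using z0 z1 \<open>0 < n\<close> by (auto simp: Z_def lattice_ball_def z1_def z0_def fun_eq_iff)
  have finZ: "finite Z" by (simp add: Z_def finite_lattice_ball)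
  then have N: "0 < card Z" using z01 by (auto simp: card_gt_0_iff)
  have r_eq: "r = real (card Z) powr (- 1 / s)" by (simp add: r_def ratio_def Z_def \<rho>_def)
  have "r powr s = real (card Z) powr (- 1 / s * s)"
    unfolding r_eq by (rule powr_powr)
  also have "\<dots> = 1 / real (card Z)"
    using assms(1) by (simp add: powr_minus_divide)
  finally have r_powr: "r powr s = 1 / real (card Z)" .
  then interpret digits r s Z
  proof unfold_locales
    show "0 < r" unfolding r_eq using N by simp
    show "r < 1" using r12 by (simp add: r_def)
    show "real (card Z) * r powr s = 1" unfolding r_powr using N by simp
  qed (use assms(1) finZ in auto)
  define p where "p t z = (if z = z0 then t *\<^sub>R lattice_point z else lattice_point z)" for t and z :: "'n \<Rightarrow> int"
  \<comment> \<open>Chosen so that \<open>r |K|\<close>, which is at most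
    \<open>2 * (T * \<rho> * r) / (1 - r) = (1 / 4) / (1 - r)\<close>, does not exceed
    \<open>1 / 2\<close> on the whole path. The digits stay 1 apart, which leaves the uniform gap
    \<open>1 / 2\<close>.\<close>
  define T where "T = 1 / (8 * (\<rho> * r))"
  have e': "\<rho> * r < 1 / 8" using e by (simp add: \<rho>_def r_def)
  have rpos: "0 < \<rho> * r" using r \<rho> by simp
  have T: "1 \<le> T" "T * \<rho> * r = 1 / 8"
    using e' rpos \<rho> r by (auto simp: T_def field_simps)
  have r2: "r < 1 / 2" using r12 by (simp add: r_def)
  have p_norm: "norm (p t z) \<le> t * \<rho>" if "1 \<le> t" "z \<in> Z" for t z
  proof -
    have "norm (lattice_point z) \<le> \<rho>" using that by (simp add: Z_def lattice_ball_def)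
    also have "\<rho> \<le> t * \<rho>" using that(1) \<rho> mult_right_mono[of 1 t \<rho>] by simp
    finally show ?thesis using that(1) z0 by (simp add: p_def)
  qed
  have p_dist: "1 \<le> dist (p t z) (p t z')" if "1 \<le> t" "z \<in> Z" "z' \<in> Z" "z \<noteq> z'" for t z z'
  proof -
    have *: "1 \<le> norm (t *\<^sub>R lattice_point z0 - lattice_point z)" if "z \<in> Z" "z \<noteq> z0" for z
      using dist_lattice_point_ge_1[OF that(2)[symmetric]] that \<open>1 \<le> t\<close> z0
        norm_scaleR_diff_ge[of t "lattice_point z" "lattice_point z0"]
      by (simp add: dist_norm Z_def lattice_ball_def)
    show ?thesis
      using that *[of z] *[of z'] dist_lattice_point_ge_1[OF that(4)]
      by (auto simp: p_def dist_norm norm_minus_commute)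
  qed
  have rK: "r * diameter (K (p t)) \<le> 1 / 2" if "1 \<le> t" "t \<le> T" for t
  proof -
    have "diameter (K (p t)) \<le> 2 * (t * \<rho>) / (1 - r)"
      using p_norm that by (intro diameter_K_le) auto
    then have "r * diameter (K (p t)) \<le> r * (2 * (t * \<rho>) / (1 - r))"
      using r by (intro mult_left_mono) auto
    also have "\<dots> \<le> r * (2 * (T * \<rho>) / (1 - r))"
      using r that \<rho> by (intro mult_left_mono divide_right_mono mult_right_mono) auto
    also have "\<dots> = 2 * (T * \<rho> * r) / (1 - r)" by (simp add: mult_ac)
    also have "\<dots> \<le> 1 / 2" using r2 unfolding T(2) by (simp add: field_simps)
    finally show ?thesis .
  qed
  have sep: "1 / 2 \<le> dist (p t z) (p t z') - r * diameter (K (p t))"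
    if "1 \<le> t" "t \<le> T" "z \<in> Z" "z' \<in> Z" "z \<noteq> z'" for t z z'
    using p_dist[OF that(1,3,4,5)] rK[OF that(1,2)] by linarith
  have p1: "p 1 = lattice_point" by (simp add: p_def fun_eq_iff)

  \<comment> \<open>At \<open>t = T\<close> the pieces other than that of \<open>z0\<close> fit into
    a set of diameter at most \<open>3 * \<rho>\<close>, while the antipodal digits give
    \<open>|K| \<ge> T * \<rho>\<close>; the quotient is
    \<open>3 / T = 24 * (\<rho> * r)\<close>.\<close>
  have "rel_measure (p T) \<le> (24 * (\<rho> * r)) powr s + r powr s"
  proof -
    define D where "D = diameter (K (p T))"
    have "T * \<rho> \<le> norm ((T + 1) *\<^sub>R lattice_point z0)"
      using z0 T(1) \<rho> by simp
    also have "\<dots> = dist (p T z0) (p T z1)"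
      using z01 z1 by (simp add: p_def dist_norm scaleR_add_left)
    also have "\<dots> \<le> D" unfolding D_def using z01 by (intro diameter_K_ge)
    finally have D: "T * \<rho> \<le> D" .
    have "0 < T * \<rho>" using T(1) \<rho> by simp
    then have "0 < D" using D by linarith
    have "hausdorff_measure s (K (p T))
        \<le> ennreal ((2 * (\<rho> + r * (T * \<rho>) / (1 - r))) powr s + r powr s * diameter (K (p T)) powr s)"
      using p_norm[OF T(1)] z01(1)
      by (intro hausdorff_measure_K_cluster) (auto simp: p_def Z_def lattice_ball_def)
    then have "enn2real (hausdorff_measure s (K (p T)))
        \<le> (2 * (\<rho> + r * (T * \<rho>) / (1 - r))) powr s + r powr s * D powr s"
      unfolding D_def by (intro enn2real_leI) auto
    also have "(2 * (\<rho> + r * (T * \<rho>) / (1 - r))) powr s \<le> (3 * \<rho>) powr s"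
    proof (intro powr_mono2)
      have "r * (T * \<rho>) = 1 / 8" using T(2) by (simp only: mult_ac)
      then have "r * (T * \<rho>) / (1 - r) = (1 / 8) / (1 - r)" by (rule arg_cong)
      also have "\<dots> \<le> 1 / 2" using r2 by (simp add: field_simps)
      finally have "r * (T * \<rho>) / (1 - r) \<le> 1 / 2" .
      moreover have "2 * (\<rho> + y) \<le> 3 * \<rho>" if "y \<le> 1 / 2" for y
        using that \<rho>(2) unfolding distrib_left by simp
      ultimately show "2 * (\<rho> + r * (T * \<rho>) / (1 - r)) \<le> 3 * \<rho>" by blast
      show "0 \<le> 2 * (\<rho> + r * (T * \<rho>) / (1 - r))" using \<rho> r T(1) by simp
    qed (use assms in auto)
    finally have "rel_measure (p T) \<le> ((3 * \<rho>) powr s + r powr s * D powr s) / D powr s"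
      unfolding rel_measure_def D_def by (intro divide_right_mono) auto
    also have "\<dots> = (3 * \<rho>) powr s / D powr s + r powr s"
      using D \<open>0 < T * \<rho>\<close> by (simp add: add_divide_distrib)
    also have "(3 * \<rho>) powr s / D powr s \<le> (3 * \<rho>) powr s / (T * \<rho>) powr s"
      using D \<open>0 < T * \<rho>\<close> \<open>0 < D\<close> assms(1) by (intro divide_left_mono powr_mono2 mult_pos_pos) auto
    also have "\<dots> = (24 * (\<rho> * r)) powr s"
      using \<rho> rpos r by (simp add: T_def field_simps flip: powr_divide)
    finally show ?thesis by simp
  qed
  then have hi: "rel_measure (p T) \<le> c" using far by (simp add: \<rho>_def r_def)

  \<comment> \<open>At \<open>t = 1\<close> the digits form the full lattice ball. With
    \<open>C = c * D powr s\<close> in \<open>hausdorff_measure_K_ge\<close>, one inequality per set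
    \<open>S\<close> of digits remains to be checked.\<close>
  have lo: "c \<le> rel_measure (p 1)"
  proof -
    define D where "D = diameter (K (p 1))"
    have D_le: "D \<le> 2 * \<rho> / (1 - r)"
      unfolding D_def using p_norm[of 1] by (intro diameter_K_le) auto
    have D0: "0 \<le> D" by (simp add: D_def diameter_K_nonneg)
    have "r * D \<le> r * (2 * \<rho> / (1 - r))" using D_le r by (intro mult_left_mono) auto
    also have "\<dots> = 2 * (\<rho> * r) * (1 / (1 - r))" by (simp add: mult_ac)
    also have "\<dots> \<le> 2 * (\<rho> * r) * 2"
      using r2 rpos by (intro mult_left_mono) (auto simp: field_simps)
    finally have rD: "r * D \<le> 4 * (\<rho> * r)" by simp
    have "ennreal (c * D powr s) \<le> hausdorff_measure s (K (p 1))"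
    proof (rule hausdorff_measure_K_ge)
      show "0 \<le> c * D powr s" using assms by simp
      show "c * D powr s \<le> diameter (K (p 1)) powr s"
        using assms mult_right_mono[of c 1 "D powr s"] by (simp add: D_def)
      fix S assume S: "S \<subseteq> Z" "2 \<le> card S"
      define x where "x = diameter (lattice_point ` S)"
      have "finite S" using S(1) finZ by (rule finite_subset)
      then have bS: "bounded (lattice_point ` S)" by (intro finite_imp_bounded) auto
      obtain z z' where z: "z \<in> S" "z' \<in> S" "z \<noteq> z'"
        using S(2) card_le_Suc0_iff_eq[OF \<open>finite S\<close>] by force
      have x1: "1 \<le> x"
        using dist_lattice_point_ge_1[OF z(3)] diameter_bounded_bound[OF bS, of "lattice_point z" "lattice_point z'"] z
        by (auto simp: x_def)
      have x2: "x \<le> 2 * \<rho>"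
        unfolding x_def
      proof (rule diameter_le_dist)
        fix a b assume "a \<in> lattice_point ` S" "b \<in> lattice_point ` S"
        then have "norm a \<le> \<rho>" "norm b \<le> \<rho>" using S(1) by (auto simp: Z_def lattice_ball_def)
        then show "dist a b \<le> 2 * \<rho>" using norm_triangle_ineq4[of a b] by (simp add: dist_norm)
      qed (use \<rho> in auto)
      have scale: "c * (2 * \<rho> / (1 - r)) powr s * (x + 2 * d) ^ CARD('n)
          \<le> 2 ^ CARD('n) * (\<rho> - d) ^ CARD('n) * (x - 4 * (\<rho> * r)) powr s"
        unfolding d_def
        using assms r r2 \<rho> e' x1 x2 x0 large small
        by (intro scale_estimate[where ?x0.0 = x0]) (auto simp: \<rho>_def r_def d_def)
      define \<omega> where "\<omega> = unit_ball_vol d"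
      have \<omega>: "0 \<le> \<omega>" by (simp add: \<omega>_def d_def)
      have "2 ^ CARD('n) * real (card S) = real (2 ^ CARD('n) * card S)" by simp
      also have "\<dots> \<le> real (card (lattice_ball (x + d) :: ('n \<Rightarrow> int) set))"
        using card_le_card_lattice_ball[OF \<open>finite S\<close>] unfolding x_def d_def of_nat_le_iff .
      also have "\<dots> \<le> \<omega> * (x + d + d) ^ CARD('n)"
        unfolding \<omega>_def d_def using x1 by (intro card_lattice_ball_upper) auto
      finally have cS: "2 ^ CARD('n) * real (card S) \<le> \<omega> * (x + 2 * d) ^ CARD('n)"
        by (simp add: algebra_simps)
      \<comment> \<open>The volume \<omega> enters the upper bound for \<open>card S\<close> and, at
        the end, the lower bound for \<open>card Z\<close>; between the two only
        \<open>scale\<close> is needed.\<close>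
      have "2 ^ CARD('n) * (c * D powr s * real (card S)) = c * D powr s * (2 ^ CARD('n) * real (card S))"
        by simp
      also have "\<dots> \<le> c * (2 * \<rho> / (1 - r)) powr s * (\<omega> * (x + 2 * d) ^ CARD('n))"
        using D_le D0 assms by (intro mult_mono[OF mult_left_mono[OF powr_mono2] cS]) auto
      also have "\<dots> = \<omega> * (c * (2 * \<rho> / (1 - r)) powr s * (x + 2 * d) ^ CARD('n))" by simp
      also have "\<dots> \<le> \<omega> * (2 ^ CARD('n) * (\<rho> - d) ^ CARD('n) * (x - 4 * (\<rho> * r)) powr s)"
        using scale \<omega> by (intro mult_left_mono)
      also have "\<dots> = 2 ^ CARD('n) * ((\<omega> * (\<rho> - d) ^ CARD('n)) * (x - 4 * (\<rho> * r)) powr s)" by simp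
      finally have "c * D powr s * real (card S) \<le> (\<omega> * (\<rho> - d) ^ CARD('n)) * (x - 4 * (\<rho> * r)) powr s"
        by (subst (asm) mult_le_cancel_left_pos) auto
      also have "\<dots> \<le> real (card Z) * (x - r * D) powr s"
      proof (intro mult_mono powr_mono2)
        show "\<omega> * (\<rho> - d) ^ CARD('n) \<le> real (card Z)"
          unfolding \<omega>_def d_def Z_def using \<rho> by (intro card_lattice_ball_lower) (auto simp: d_def)
      qed (use rD e' x1 assms in auto)
      finally show "r * diameter (K (p 1)) \<le> diameter (p 1 ` S) \<and>
          c * D powr s * real (card S) \<le> real (card Z) * (diameter (p 1 ` S) - r * diameter (K (p 1))) powr s"
        using rD e' x1 by (simp add: p1 x_def D_def)
    qed
    then have "c * D powr s \<le> enn2real (hausdorff_measure s (K (p 1)))"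
      by (subst (asm) hausdorff_measure_K_eq) (simp add: ennreal_le_iff)
    moreover have "0 < D"
      using diameter_K_ge[OF z01(1,2), of "p 1"] p_dist[of 1 z0 z1] z01 by (simp add: D_def)
    ultimately show ?thesis by (simp add: rel_measure_def field_simps flip: D_def)
  qed

  \<comment> \<open>Only \<open>z0\<close> moves, along a vector of norm \<rho>.\<close>
  have Lip: "norm (p t' z - p t z) \<le> \<rho> * \<bar>t' - t\<bar>" for t t' z
    using z0 \<rho> by (auto simp: p_def simp flip: scaleR_diff_left)
  obtain t where t: "1 \<le> t" "t \<le> T" "rel_measure (p t) = c"
    by (rule rel_measure_intermediate_value[of "1 / 2" 1 T \<rho> p c]) (use T \<rho> sep Lip hi lo in auto)
  have "r * diameter (K (p t)) < dist (p t z) (p t z')" if "z \<in> Z" "z' \<in> Z" "z \<noteq> z'" for z z'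
    using sep[OF t(1,2) that] by linarith
  from K_solves[of "p t", OF this t(3) assms(3)] show ?thesis by blast
qed

end
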